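(* If $X$ is a coverable metric space, then $X$ is uniformly homeomorphic to the metric quotient $Y/G$ of a universal metric space $Y$ with respect to an isometric prodiscrete action of a group $G$ isomorphic to the deck group $\delta_1(X)$.
   Context: All entourages are taken to be symmetric; $B(x,E)=\{y:(x,y)\in E\}$. Each space has a fixed basepoint $*$; metric spaces carry their metric uniformity. For an entourage $E$ of a uniform space $X$, an $E$-chain from $p$ to $q$ is a finite sequence $\{x_0=p,\dots,x_n=q\}$ with $(x_i,x_{i+1})\in E$ for all $i$; it is an $E$-loop if $p=q$. Two $E$-chains with the same endpoints are $E$-homotopic if one is obtained from the other in finitely many steps, each adding or removing a single point, always keeping the endpoints fixed and keeping an $E$-chain at each stage (in particular $\{p\}$ and $\{p,p\}$ are $E$-homotopic); $[\alpha]_E$ is the class of $\alpha$. $X_E$ is the set of $E$-homotopy classes of $E$-chains starting at $*$, with basepoint $[*]_E$. For an entourage $D\subset E$ let $D^*$ be the set of pairs $([*=x_0,\dots,x_n,y]_E,[*=x_0,\dots,x_n,z]_E)$ with $(y,z)\in D$; $X_E$ carries the uniformity with base $\{D^*:D\subset E\}$. The endpoint map is $\phi_{XE}:X_E\to X$, and for $D\subset E$, $\phi_{ED}:X_D\to X_E$ is $[\alpha]_D\mapsto[\alpha]_E$. $\widetilde{X}=\varprojlim X_E$ (over all entourages, ordered by reverse inclusion, with the inverse limit uniformity), with projections $\phi_E:\widetilde{X}\to X_E$. $X$ is coverable if its uniformity has a base, containing $X\times X$, of entourages $E$ for which $\phi_E$ is surjective. $X$ is universal if its uniformity has a base $\mathcal{U}$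 such that for every $E\in\mathcal{U}$ the map $\phi_{XE}:X_E\to X$ is a uniform homeomorphism. $\delta_E(X)$ is the group of $E$-homotopy classes of $E$-loops at $*$ under concatenation, and the deck group is $\delta_1(X)=\varprojlim\delta_E(X)$, the bonding maps being $[\lambda]_F\mapsto[\lambda]_E$ for $F\subset E$. A group $G$ acting on a uniform space $Y$ by uniform homeomorphisms acts discretely if there is an entourage $E$ such that $(g(y),y)\in E$ for some $y\in Y$ implies $g=1$; it acts prodiscretely if the action is an inverse limit of discrete actions, i.e. $Y=\varprojlim Y_\alpha$ (with the inverse limit uniformity, projections surjective), $G=\varprojlim G_\alpha$ over the same directed set, each $G_\alpha$ acts discretely on $Y_\alpha$ by uniform homeomorphisms, the bonding maps $Y_\beta\to Y_\alpha$ (uniformly continuous) are equivariant with respect to the bonding homomorphisms $G_\beta\to G_\alpha$, and $G$ acts coordinatewise. The metric quotient $Y/G$ of a metric space $Y$ by an isometric action of $G$ with closed orbits is the orbit space, with the distance between two points of $Y/G$ being the distance (infimum) in $Y$ between the corresponding orbits. *)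

theory Defs
  imports "HOL-Analysis.Abstract_Metric_Spaces" "HOL-Algebra.Group_Action"
begin

section \<open>Uniform spaces on a carrier set\<close>

text \<open>
  A uniformity on a set \<open>S\<close> is a filter on pairs concentrated on \<open>S \<times> S\<close>; the conditions are
  those of the type class \<^class>\<open>uniform_space\<close>, relativised to a carrier. Carriers are needed
  since the spaces of homotopy classes below depend on an entourage. Uniform spaces are not
  required to be Hausdorff.
\<close>

definition uniform_space_on :: "'a set \<Rightarrow> ('a \<times> 'a) filter \<Rightarrow> bool" where
  "uniform_space_on S U \<longleftrightarrow>
     U \<le> principal (S \<times> S) \<and>
     (\<forall>E. eventually E U \<longrightarrow> (\<forall>x\<in>S. E (x, x))) \<and>
     (\<forall>E. eventually E U \<longrightarrow> (\<forall>\<^sub>F (x, y) in U. E (y, x))) \<and>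
     (\<forall>E. eventually E U \<longrightarrow>
        (\<exists>D. eventually D U \<and> (\<forall>x y z. D (x, y) \<longrightarrow> D (y, z) \<longrightarrow> E (x, z))))"

text \<open>Entourages are symmetric by convention.\<close>

definition entourages :: "'a set \<Rightarrow> ('a \<times> 'a) filter \<Rightarrow> 'a rel set" where
  "entourages S U = {E. E \<subseteq> S \<times> S \<and> sym E \<and> (\<forall>\<^sub>F p in U. p \<in> E)}"

definition entourage_base :: "'a set \<Rightarrow> ('a \<times> 'a) filter \<Rightarrow> 'a rel set \<Rightarrow> bool" where
  "entourage_base S U B \<longleftrightarrow> B \<subseteq> entourages S U \<and> (\<forall>E\<in>entourages S U. \<exists>D\<in>B. D \<subseteq> E)"

definition uniformly_continuous_between ::
    "'a set \<Rightarrow> ('a \<times> 'a) filter \<Rightarrow> 'b set \<Rightarrow> ('b \<times> 'b) filter \<Rightarrow> ('a \<Rightarrow> 'b) \<Rightarrow> bool" where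
  "uniformly_continuous_between S U T V f \<longleftrightarrow>
     f \<in> S \<rightarrow> T \<and> filterlim (\<lambda>(x, y). (f x, f y)) V U"

definition uniform_homeomorphism ::
    "'a set \<Rightarrow> ('a \<times> 'a) filter \<Rightarrow> 'b set \<Rightarrow> ('b \<times> 'b) filter \<Rightarrow> ('a \<Rightarrow> 'b) \<Rightarrow> bool" where
  "uniform_homeomorphism S U T V f \<longleftrightarrow>
     bij_betw f S T \<and>
     uniformly_continuous_between S U T V f \<and>
     uniformly_continuous_between T V S U (inv_into S f)"

definition metric_uniformity :: "'a set \<Rightarrow> ('a \<Rightarrow> 'a \<Rightarrow> real) \<Rightarrow> ('a \<times> 'a) filter" where
  "metric_uniformity M d = (INF e\<in>{0<..}. principal {(x, y). x \<in> M \<and> y \<in> M \<and> d x y < e})"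


section \<open>Chains and their homotopy classes\<close>

definition is_chain :: "'a set \<Rightarrow> 'a rel \<Rightarrow> 'a list \<Rightarrow> bool" where
  "is_chain S E c \<longleftrightarrow> c \<noteq> [] \<and> set c \<subseteq> S \<and> successively (\<lambda>x y. (x, y) \<in> E) c"

definition insertion_step :: "'a set \<Rightarrow> 'a rel \<Rightarrow> 'a list rel" where
  "insertion_step S E =
     {(c, c'). is_chain S E c \<and> is_chain S E c' \<and> hd c = hd c' \<and> last c = last c' \<and>
               (\<exists>xs z ys. c = xs @ ys \<and> c' = xs @ z # ys)}"

definition chain_class :: "'a set \<Rightarrow> 'a rel \<Rightarrow> 'a list \<Rightarrow> 'a list set" where
  "chain_class S E c = {c'. (c, c') \<in> (insertion_step S E \<union> (insertion_step S E)\<inverse>)\<^sup>*}"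

text \<open>The space \<open>X\<^sub>E\<close> for \<open>X = (S, U)\<close> with basepoint \<open>p\<close>.\<close>

definition chain_space :: "'a set \<Rightarrow> 'a \<Rightarrow> 'a rel \<Rightarrow> 'a list set set" where
  "chain_space S p E = {chain_class S E c | c. is_chain S E c \<and> hd c = p}"

text \<open>The lift \<open>D\<^sup>*\<close> of \<open>D \<subseteq> E\<close> to \<open>X\<^sub>E\<close>.\<close>

definition lift_entourage :: "'a set \<Rightarrow> 'a \<Rightarrow> 'a rel \<Rightarrow> 'a rel \<Rightarrow> 'a list set rel" where
  "lift_entourage S p E D =
     {(chain_class S E (xs @ [y]), chain_class S E (xs @ [z])) | xs y z.
        xs \<noteq> [] \<and> hd xs = p \<and> is_chain S E (xs @ [y]) \<and> is_chain S E (xs @ [z]) \<and> (y, z) \<in> D}"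

definition chain_uniformity ::
    "'a set \<Rightarrow> 'a \<Rightarrow> ('a \<times> 'a) filter \<Rightarrow> 'a rel \<Rightarrow> ('a list set \<times> 'a list set) filter" where
  "chain_uniformity S p U E =
     (INF D\<in>{D \<in> entourages S U. D \<subseteq> E}. principal (lift_entourage S p E D))"

text \<open>All members of a class have the same last point.\<close>

definition endpoint :: "'a list set \<Rightarrow> 'a" where
  "endpoint C = the_elem (last ` C)"

text \<open>
  The map \<open>[c]\<^sub>D \<mapsto> [c]\<^sub>E\<close> for \<open>D \<subseteq> E\<close>: all members of \<open>[c]\<^sub>D\<close> have the same class with
  respect to \<open>E\<close>, so the union is that class.
\<close>

definition chain_bond :: "'a set \<Rightarrow> 'a rel \<Rightarrow> 'a rel \<Rightarrow> 'a list set \<Rightarrow> 'a list set" where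
  "chain_bond S E D C = (\<Union>c\<in>C. chain_class S E c)"


section \<open>Inverse limits\<close>

text \<open>\<open>(i, j) \<in> r\<close> means that \<open>i\<close> precedes \<open>j\<close>; the bonding map \<open>f i j\<close> goes from \<open>S j\<close> to \<open>S i\<close>.\<close>

definition directed_set :: "'i set \<Rightarrow> 'i rel \<Rightarrow> bool" where
  "directed_set I r \<longleftrightarrow>
     I \<noteq> {} \<and> preorder_on I r \<and> (\<forall>i\<in>I. \<forall>j\<in>I. \<exists>k\<in>I. (i, k) \<in> r \<and> (j, k) \<in> r)"

definition inverse_system ::
    "'i set \<Rightarrow> 'i rel \<Rightarrow> ('i \<Rightarrow> 's set) \<Rightarrow> ('i \<Rightarrow> 'i \<Rightarrow> 's \<Rightarrow> 's) \<Rightarrow> bool" where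
  "inverse_system I r S f \<longleftrightarrow>
     (\<forall>(i, j)\<in>r. f i j \<in> S j \<rightarrow> S i) \<and>
     (\<forall>i\<in>I. \<forall>x\<in>S i. f i i x = x) \<and>
     (\<forall>i j k. (i, j) \<in> r \<longrightarrow> (j, k) \<in> r \<longrightarrow> (\<forall>x\<in>S k. f i j (f j k x) = f i k x))"

definition inverse_limit ::
    "'i set \<Rightarrow> 'i rel \<Rightarrow> ('i \<Rightarrow> 's set) \<Rightarrow> ('i \<Rightarrow> 'i \<Rightarrow> 's \<Rightarrow> 's) \<Rightarrow> ('i \<Rightarrow> 's) set" where
  "inverse_limit I r S f = {x \<in> Pi\<^sub>E I S. \<forall>(i, j)\<in>r. f i j (x j) = x i}"

definition inverse_limit_uniformity ::
    "'i set \<Rightarrow> 'i rel \<Rightarrow> ('i \<Rightarrow> 's set) \<Rightarrow> ('i \<Rightarrow> 'i \<Rightarrow> 's \<Rightarrow> 's) \<Rightarrow> ('i \<Rightarrow> ('s \<times> 's) filter) \<Rightarrow>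
     (('i \<Rightarrow> 's) \<times> ('i \<Rightarrow> 's)) filter" where
  "inverse_limit_uniformity I r S f U =
     inf (principal (inverse_limit I r S f \<times> inverse_limit I r S f))
         (INF i\<in>I. filtercomap (\<lambda>(x, y). (x i, y i)) (U i))"

definition inverse_limit_group ::
    "'i set \<Rightarrow> 'i rel \<Rightarrow> ('i \<Rightarrow> 'h monoid) \<Rightarrow> ('i \<Rightarrow> 'i \<Rightarrow> 'h \<Rightarrow> 'h) \<Rightarrow> ('i \<Rightarrow> 'h) monoid" where
  "inverse_limit_group I r H h =
     \<lparr>carrier = inverse_limit I r (\<lambda>i. carrier (H i)) h,
      mult = (\<lambda>x y. \<lambda>i\<in>I. x i \<otimes>\<^bsub>H i\<^esub> y i),
      one = (\<lambda>i\<in>I. \<one>\<^bsub>H i\<^esub>)\<rparr>"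


section \<open>Coverable and universal spaces, the deck group\<close>

definition reverse_inclusion :: "'a rel set \<Rightarrow> ('a rel) rel" where
  "reverse_inclusion B = {(E, D). E \<in> B \<and> D \<in> B \<and> D \<subseteq> E}"

text \<open>
  The underlying set of the inverse limit of the \<open>X\<^sub>E\<close>; its uniformity does not enter the
  notions of this section. The projection to \<open>X\<^sub>E\<close> is evaluation at \<open>E\<close>.
\<close>

definition chain_limit :: "'a set \<Rightarrow> 'a \<Rightarrow> ('a \<times> 'a) filter \<Rightarrow> ('a rel \<Rightarrow> 'a list set) set" where
  "chain_limit S p U =
     inverse_limit (entourages S U) (reverse_inclusion (entourages S U))
       (chain_space S p) (chain_bond S)"

definition coverable :: "'a set \<Rightarrow> 'a \<Rightarrow> ('a \<times> 'a) filter \<Rightarrow> bool" where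
  "coverable S p U \<longleftrightarrow>
     (\<exists>B. entourage_base S U B \<and> S \<times> S \<in> B \<and>
          (\<forall>E\<in>B. (\<lambda>x. x E) ` chain_limit S p U = chain_space S p E))"

definition universal :: "'a set \<Rightarrow> 'a \<Rightarrow> ('a \<times> 'a) filter \<Rightarrow> bool" where
  "universal S p U \<longleftrightarrow>
     (\<exists>B. entourage_base S U B \<and>
          (\<forall>E\<in>B. uniform_homeomorphism (chain_space S p E) (chain_uniformity S p U E) S U endpoint))"

text \<open>
  The group \<open>\<delta>\<^sub>E(X)\<close>. The product of two classes is the class of the concatenation of any
  representatives, in which the common basepoint is written once.
\<close>

definition loop_group :: "'a set \<Rightarrow> 'a \<Rightarrow> 'a rel \<Rightarrow> 'a list set monoid" where
  "loop_group S p E =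
     \<lparr>carrier = {chain_class S E c | c. is_chain S E c \<and> hd c = p \<and> last c = p},
      mult = (\<lambda>A B. \<Union>a\<in>A. \<Union>b\<in>B. chain_class S E (a @ tl b)),
      one = chain_class S E [p]\<rparr>"

definition deck_group ::
    "'a set \<Rightarrow> 'a \<Rightarrow> ('a \<times> 'a) filter \<Rightarrow> ('a rel \<Rightarrow> 'a list set) monoid" where
  "deck_group S p U =
     inverse_limit_group (entourages S U) (reverse_inclusion (entourages S U))
       (loop_group S p) (chain_bond S)"


section \<open>Actions\<close>

definition uniform_action ::
    "'g monoid \<Rightarrow> 'y set \<Rightarrow> ('y \<times> 'y) filter \<Rightarrow> ('g \<Rightarrow> 'y \<Rightarrow> 'y) \<Rightarrow> bool" where
  "uniform_action G S U \<phi> \<longleftrightarrow>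
     uniform_space_on S U \<and> group_action G S \<phi> \<and>
     (\<forall>g\<in>carrier G. uniform_homeomorphism S U S U (\<phi> g))"

definition discrete_action ::
    "'g monoid \<Rightarrow> 'y set \<Rightarrow> ('y \<times> 'y) filter \<Rightarrow> ('g \<Rightarrow> 'y \<Rightarrow> 'y) \<Rightarrow> bool" where
  "discrete_action G S U \<phi> \<longleftrightarrow>
     uniform_action G S U \<phi> \<and>
     (\<exists>E\<in>entourages S U. \<forall>g\<in>carrier G. (\<exists>y\<in>S. (\<phi> g y, y) \<in> E) \<longrightarrow> g = \<one>\<^bsub>G\<^esub>)"

text \<open>
  The first three arguments only name the types over which the index set, the spaces and the
  groups of the inverse system range, as HOL cannot quantify over types. The identifications of
  the space and of the group with the respective limits are \<open>P\<close> and \<open>Q\<close>; their components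
  \<open>\<lambda>y. P y i\<close> and \<open>\<lambda>g. Q g i\<close> are the projections.
\<close>

definition prodiscrete_action ::
    "'i itself \<Rightarrow> 's itself \<Rightarrow> 'h itself \<Rightarrow>
     'g monoid \<Rightarrow> 'y set \<Rightarrow> ('y \<times> 'y) filter \<Rightarrow> ('g \<Rightarrow> 'y \<Rightarrow> 'y) \<Rightarrow> bool" where
  "prodiscrete_action _ _ _ G S U \<phi> \<longleftrightarrow>
     uniform_action G S U \<phi> \<and>
     (\<exists>(I :: 'i set) r (T :: 'i \<Rightarrow> 's set) V f (H :: 'i \<Rightarrow> 'h monoid) h \<psi> P Q.
        directed_set I r \<and>
        inverse_system I r T f \<and>
        inverse_system I r (\<lambda>i. carrier (H i)) h \<and>
        (\<forall>i\<in>I. discrete_action (H i) (T i) (V i) (\<psi> i)) \<and>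
        (\<forall>(i, j)\<in>r.
           uniformly_continuous_between (T j) (V j) (T i) (V i) (f i j) \<and>
           h i j \<in> hom (H j) (H i) \<and>
           (\<forall>g\<in>carrier (H j). \<forall>x\<in>T j. f i j (\<psi> j g x) = \<psi> i (h i j g) (f i j x))) \<and>
        uniform_homeomorphism S U
          (inverse_limit I r T f) (inverse_limit_uniformity I r T f V) P \<and>
        (\<forall>i\<in>I. (\<lambda>y. P y i) ` S = T i) \<and>
        Q \<in> iso G (inverse_limit_group I r H h) \<and>
        (\<forall>g\<in>carrier G. \<forall>y\<in>S. \<forall>i\<in>I. P (\<phi> g y) i = \<psi> i (Q g i) (P y i)))"

definition isometric_action ::
    "'g monoid \<Rightarrow> 'y set \<Rightarrow> ('y \<Rightarrow> 'y \<Rightarrow> real) \<Rightarrow> ('g \<Rightarrow> 'y \<Rightarrow> 'y) \<Rightarrow> bool" where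
  "isometric_action G Y d \<phi> \<longleftrightarrow>
     group_action G Y \<phi> \<and>
     (\<forall>g\<in>carrier G. \<forall>x\<in>Y. \<forall>y\<in>Y. d (\<phi> g x) (\<phi> g y) = d x y)"

text \<open>
  The distance of the metric quotient, whose underlying set is \<^const>\<open>orbits\<close>.
\<close>

definition orbit_dist :: "('y \<Rightarrow> 'y \<Rightarrow> real) \<Rightarrow> 'y set \<Rightarrow> 'y set \<Rightarrow> real" where
  "orbit_dist d A B = Inf {d a b | a b. a \<in> A \<and> b \<in> B}"

end

theory Submission
  imports Defs
begin

text \<open>
Write \<open>X\<close> for the given metric space and \<open>N r\<close> for the entourage \<open>d x y < r\<close>. The space \<open>Y\<close>
is the inverse limit of the spaces \<open>X\<^sub>E\<close> and \<open>G\<close> is the deck group itself, acting on each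
coordinate by prefixing a loop to a chain.

\<^bold>\<open>The metric.\<close> Call two points of the limit \<open>r\<close>-near if their coordinates in \<open>X\<^sub>E\<close>, \<open>E = N r\<close>,
are \<open>E\<^sup>*\<close>-close: the second class arises from the first by one more step of length less than \<open>r\<close>.
If \<open>x\<close>, \<open>y\<close> are \<open>r\<close>-near and \<open>y\<close>, \<open>z\<close> are \<open>s\<close>-near then, at scale \<open>r + s\<close>, the two
steps can be homotoped to a single one, because its length is less than \<open>r + s\<close> by the triangle
inequality of \<open>X\<close>. Hence scales add, and the infimum of the admissible scales is a metric
(locale \<open>scales\<close>); it is finite because at a large scale every chain contracts to a single edge.
It is invariant under \<open>G\<close>, since loops act on the beginning of a chain and
nearness concerns its end, and it induces the inverse limit uniformity.

\<^bold>\<open>The quotient.\<close> Two classes with a common endpoint differ by a loop, compatibly in \<open>E\<close>, so the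
orbits of \<open>G\<close> are exactly the fibres of the endpoint map \<open>Y \<rightarrow> X\<close> (\<open>orbit_eq_fibre\<close>). That map does
not increase distances. Conversely, if \<open>X\<^sub>F\<close> is covered by the limit, a step \<open>(m, n) \<in> F\<close> lifts to
a short step starting over \<open>m\<close>, so close points of \<open>X\<close> have close fibres (\<open>orbit_dist_small\<close>).

\<^bold>\<open>Universality.\<close> Let \<open>E\<close> belong to a base for which \<open>Y \<rightarrow> X\<^sub>E\<close> is onto, and let \<open>W\<close> be the
preimage of \<open>E\<^sup>*\<close> in \<open>Y\<close>; these \<open>W\<close> form a base of the uniformity of \<open>Y\<close>. A \<open>W\<close>-chain from the
basepoint is the same thing, up to moving vertices within the fibres of \<open>Y \<rightarrow> X\<^sub>E\<close>, as the sequence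
of classes of the initial segments of an \<open>E\<close>-chain in \<open>X\<close>. If two \<open>W\<close>-chains have the same endpoint,
their \<open>E\<close>-chains are \<open>E\<close>-homotopic, and this homotopy lifts step by step. So the endpoint map
\<open>Y\<^sub>W \<rightarrow> Y\<close> is bijective (locale \<open>chain_pullback\<close>), and a bijective endpoint map is a uniform
homeomorphism (\<open>uniform_homeomorphism_endpoint\<close>).

\<^bold>\<open>Prodiscreteness.\<close> The entourages of the same base index a cofinal subsystem, over which the
projections are onto; restriction of the index set identifies both \<open>Y\<close> and \<open>G\<close> with the limits
over this subsystem, and the group of loops acts discretely on each \<open>X\<^sub>E\<close>
(\<open>discrete_loop_action\<close>).
\<close>

section \<open>Uniformities given by entourages and by metrics\<close>

text \<open>
  The properties of an entourage on which the homotopy theory of chains depends.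
\<close>

definition tolerance :: "'a set \<Rightarrow> 'a rel \<Rightarrow> bool" where
  "tolerance S E \<longleftrightarrow> E \<subseteq> S \<times> S \<and> sym E \<and> refl_on S E"

lemma toleranceD:
  assumes "tolerance S E"
  shows "(x, y) \<in> E \<Longrightarrow> x \<in> S" "(x, y) \<in> E \<Longrightarrow> y \<in> S" "(x, y) \<in> E \<Longrightarrow> (y, x) \<in> E"
    "x \<in> S \<Longrightarrow> (x, x) \<in> E"
  using assms unfolding tolerance_def by (auto dest: symD refl_onD)

lemma entourages_tolerance:
  assumes "uniform_space_on S U" "E \<in> entourages S U"
  shows "tolerance S E"
proof -
  have "\<forall>x\<in>S. (x, x) \<in> E"
    using assms unfolding uniform_space_on_def entourages_def by blast
  thus ?thesis using assms(2) by (auto simp: tolerance_def entourages_def refl_on_def)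
qed

lemma entourages_Int:
  assumes "D \<in> entourages S U" "E \<in> entourages S U"
  shows "D \<inter> E \<in> entourages S U"
  using assms unfolding entourages_def by (auto intro: eventually_conj sym_Int)

lemma eventually_uniformity_iff_entourage:
  assumes "uniform_space_on S U"
  shows "eventually P U \<longleftrightarrow> (\<exists>D\<in>entourages S U. \<forall>q\<in>D. P q)"
proof
  assume P: "eventually P U"
  let ?D = "{(x, y). (x, y) \<in> S \<times> S \<and> P (x, y) \<and> P (y, x)}"
  have "\<forall>\<^sub>F (x, y) in U. P (y, x)" using assms P unfolding uniform_space_on_def by blast
  moreover have "\<forall>\<^sub>F q in U. q \<in> S \<times> S"
    using assms unfolding uniform_space_on_def le_principal by blast
  ultimately have "\<forall>\<^sub>F q in U. q \<in> ?D" using P by eventually_elim auto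
  moreover have "sym ?D" by (rule symI) auto
  moreover have "?D \<subseteq> S \<times> S" by auto
  ultimately have "?D \<in> entourages S U" unfolding entourages_def by simp
  moreover have "\<forall>q\<in>?D. P q" by auto
  ultimately show "\<exists>D\<in>entourages S U. \<forall>q\<in>D. P q" ..
next
  assume "\<exists>D\<in>entourages S U. \<forall>q\<in>D. P q"
  thus "eventually P U" unfolding entourages_def by (auto elim!: eventually_mono)
qed

lemma entourages_halving:
  assumes U: "uniform_space_on S U" and E: "E \<in> entourages S U"
  obtains D where "D \<in> entourages S U" "D \<subseteq> E" "\<And>x y z. (x, y) \<in> D \<Longrightarrow> (y, z) \<in> D \<Longrightarrow> (x, z) \<in> E"
proof -
  have "eventually (\<lambda>q. q \<in> E) U" using E by (simp add: entourages_def)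
  moreover have "\<forall>E. eventually E U \<longrightarrow>
      (\<exists>D. eventually D U \<and> (\<forall>x y z. D (x, y) \<longrightarrow> D (y, z) \<longrightarrow> E (x, z)))"
    using U by (simp add: uniform_space_on_def)
  ultimately obtain Q
    where Q: "eventually Q U" "\<And>x y z. Q (x, y) \<Longrightarrow> Q (y, z) \<Longrightarrow> (x, z) \<in> E"
    by blast
  obtain D where D: "D \<in> entourages S U" "\<forall>q\<in>D. Q q"
    using Q(1) eventually_uniformity_iff_entourage[OF U] by blast
  show thesis
    using that[of "D \<inter> E"] entourages_Int[OF D(1) E] D(2) Q(2) by blast
qed

definition metric_entourage :: "'a set \<Rightarrow> ('a \<Rightarrow> 'a \<Rightarrow> real) \<Rightarrow> real \<Rightarrow> 'a rel" where
  "metric_entourage M d r = {(x, y). x \<in> M \<and> y \<in> M \<and> d x y < r}"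

lemma eventually_metric_uniformity:
  "eventually P (metric_uniformity M d) \<longleftrightarrow> (\<exists>e>0. \<forall>q\<in>metric_entourage M d e. P q)"
proof -
  have "eventually P (metric_uniformity M d) \<longleftrightarrow>
      (\<exists>e\<in>{0<..}. eventually P (principal {(x, y). x \<in> M \<and> y \<in> M \<and> d x y < e}))"
    unfolding metric_uniformity_def
  proof (rule eventually_INF_base)
    fix a b :: real assume "a \<in> {0<..}" "b \<in> {0<..}"
    thus "\<exists>x\<in>{0<..}. principal {(u, v). u \<in> M \<and> v \<in> M \<and> d u v < x}
        \<le> inf (principal {(x, y). x \<in> M \<and> y \<in> M \<and> d x y < a})
              (principal {(x, y). x \<in> M \<and> y \<in> M \<and> d x y < b})"
      by (intro bexI[of _ "min a b"]) auto
  qed (auto intro: gt_ex)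
  thus ?thesis by (simp add: eventually_principal metric_entourage_def Bex_def)
qed

lemma uniform_space_on_metric:
  assumes "Metric_space M d"
  shows "uniform_space_on M (metric_uniformity M d)"
proof -
  interpret Metric_space M d by fact
  have "\<exists>D. eventually D (metric_uniformity M d) \<and>
          (\<forall>x y z. D (x, y) \<longrightarrow> D (y, z) \<longrightarrow> E (x, z))"
    if E: "eventually E (metric_uniformity M d)" for E
  proof -
    obtain e where e: "e > 0" "\<forall>q\<in>metric_entourage M d e. E q"
      using E[unfolded eventually_metric_uniformity] by blast
    let ?D = "\<lambda>q. q \<in> metric_entourage M d (e/2)"
    have "eventually ?D (metric_uniformity M d)"
      unfolding eventually_metric_uniformity using e(1) by (intro exI[of _ "e/2"]) auto
    moreover have "E (x, z)" if xy: "?D (x, y)" and yz: "?D (y, z)" for x y z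
    proof -
      have "d x z < e"
        using triangle[of x y z] xy yz by (auto simp: metric_entourage_def)
      thus ?thesis using xy yz e(2) by (auto simp: metric_entourage_def)
    qed
    ultimately show ?thesis by blast
  qed
  moreover have "metric_uniformity M d \<le> principal (M \<times> M)"
    unfolding le_principal eventually_metric_uniformity
    by (intro exI[of _ 1]) (auto simp: metric_entourage_def)
  moreover have "E (x, x)" if "eventually E (metric_uniformity M d)" "x \<in> M" for E x
    using that unfolding eventually_metric_uniformity by (auto simp: metric_entourage_def)
  moreover have "\<forall>\<^sub>F (x, y) in metric_uniformity M d. E (y, x)"
    if E: "eventually E (metric_uniformity M d)" for E
  proof -
    obtain e where "e > 0" "\<forall>q\<in>metric_entourage M d e. E q"
      using E[unfolded eventually_metric_uniformity] by blast
    thus ?thesis unfolding eventually_metric_uniformity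
      by (intro exI[of _ e]) (auto simp: metric_entourage_def commute[of _ x for x])
  qed
  ultimately show ?thesis unfolding uniform_space_on_def by blast
qed

lemma metric_entourage_in_entourages:
  assumes "Metric_space M d" "r > 0"
  shows "metric_entourage M d r \<in> entourages M (metric_uniformity M d)"
proof -
  interpret Metric_space M d by fact
  have "sym (metric_entourage M d r)"
    by (rule symI) (simp add: metric_entourage_def commute)
  thus ?thesis using assms(2)
    by (auto simp: entourages_def eventually_metric_uniformity metric_entourage_def
        intro!: exI[of _ r])
qed

lemma entourage_contains_metric:
  assumes "E \<in> entourages M (metric_uniformity M d)"
  obtains r where "r > 0" "metric_entourage M d r \<subseteq> E"
  using assms by (auto simp: entourages_def eventually_metric_uniformity)

lemma uniformly_continuous_between_metric:
  "uniformly_continuous_between M (metric_uniformity M d) N (metric_uniformity N d') f \<longleftrightarrow>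
     f \<in> M \<rightarrow> N \<and> (\<forall>e>0. \<exists>r>0. \<forall>x\<in>M. \<forall>y\<in>M. d x y < r \<longrightarrow> d' (f x) (f y) < e)"
proof -
  have "filterlim (\<lambda>(x, y). (f x, f y)) (metric_uniformity N d') (metric_uniformity M d) \<longleftrightarrow>
      (\<forall>e>0. \<exists>r>0. \<forall>x\<in>M. \<forall>y\<in>M. d x y < r \<longrightarrow> d' (f x) (f y) < e)" if "f \<in> M \<rightarrow> N"
    unfolding metric_uniformity_def[of N] filterlim_INF filterlim_principal
      eventually_metric_uniformity metric_entourage_def
    using that by (simp add: Pi_iff Ball_def imp_conjL)
  thus ?thesis unfolding uniformly_continuous_between_def by blast
qed

text \<open>
  A separating family of reflexive symmetric relations \<open>R r\<close>, indexed by scales \<open>r > 0\<close>, whose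
  scales add under composition, is the family of balls of a metric up to an arbitrarily small
  change of scale. Outside \<open>Y\<close> the value \<open>0\<close> is chosen because non-negativity and symmetry of a
  \<^locale>\<open>Metric_space\<close> concern all elements of the type.
\<close>

definition scale_dist :: "(real \<Rightarrow> 'y \<Rightarrow> 'y \<Rightarrow> bool) \<Rightarrow> 'y set \<Rightarrow> 'y \<Rightarrow> 'y \<Rightarrow> real" where
  "scale_dist R Y x y = (if x \<in> Y \<and> y \<in> Y then Inf {r. 0 < r \<and> R r x y} else 0)"

locale scales =
  fixes R :: "real \<Rightarrow> 'y \<Rightarrow> 'y \<Rightarrow> bool" and Y :: "'y set"
  assumes scale_refl: "\<And>r x. 0 < r \<Longrightarrow> x \<in> Y \<Longrightarrow> R r x x"
    and scale_sym: "\<And>r x y. 0 < r \<Longrightarrow> x \<in> Y \<Longrightarrow> y \<in> Y \<Longrightarrow> R r x y \<Longrightarrow> R r y x"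
    and scale_add: "\<And>r s x y z. 0 < r \<Longrightarrow> 0 < s \<Longrightarrow> x \<in> Y \<Longrightarrow> y \<in> Y \<Longrightarrow> z \<in> Y \<Longrightarrow>
                      R r x y \<Longrightarrow> R s y z \<Longrightarrow> R (r + s) x z"
    and scale_ex: "\<And>x y. x \<in> Y \<Longrightarrow> y \<in> Y \<Longrightarrow> \<exists>r>0. R r x y"
    and scale_separated: "\<And>x y. x \<in> Y \<Longrightarrow> y \<in> Y \<Longrightarrow> (\<And>r. 0 < r \<Longrightarrow> R r x y) \<Longrightarrow> x = y"
begin

lemma scale_mono:
  assumes "0 < r" "r \<le> s" "x \<in> Y" "y \<in> Y" "R r x y"
  shows "R s x y"
proof (cases "r = s")
  case False
  thus ?thesis using scale_add[of r "s - r" x y y] scale_refl[of "s - r" y] assms by simp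
qed (use assms in simp)

lemma scale_dist_le:
  assumes "0 < r" "x \<in> Y" "y \<in> Y" "R r x y"
  shows "scale_dist R Y x y \<le> r"
  using assms by (auto simp: scale_dist_def intro!: cInf_lower bdd_belowI[of _ 0])

lemma scale_dist_less:
  assumes "x \<in> Y" "y \<in> Y" "scale_dist R Y x y < r"
  obtains s where "0 < s" "s < r" "R s x y"
proof -
  have "{r. 0 < r \<and> R r x y} \<noteq> {}" using scale_ex assms by auto
  moreover have "Inf {r. 0 < r \<and> R r x y} < r" using assms by (simp add: scale_dist_def)
  ultimately obtain s where "s \<in> {r. 0 < r \<and> R r x y}" "s < r" using cInf_lessD by metis
  thus thesis using that[of s] by simp
qed

lemma scale_dist_lessD:
  assumes "x \<in> Y" "y \<in> Y" "scale_dist R Y x y < r"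
  shows "R r x y"
  using scale_dist_less[OF assms] scale_mono assms(1,2) less_imp_le by metis

lemma scale_dist_nonneg: "0 \<le> scale_dist R Y x y"
proof (cases "x \<in> Y \<and> y \<in> Y")
  case True
  hence "{r. 0 < r \<and> R r x y} \<noteq> {}" using scale_ex by auto
  thus ?thesis using True by (auto simp: scale_dist_def intro!: cInf_greatest)
qed (auto simp: scale_dist_def)

lemma Metric_space_scale_dist: "Metric_space Y (scale_dist R Y)"
proof
  fix x y
  show "0 \<le> scale_dist R Y x y" by (rule scale_dist_nonneg)
  have "x \<in> Y \<Longrightarrow> y \<in> Y \<Longrightarrow> {r. 0 < r \<and> R r x y} = {r. 0 < r \<and> R r y x}"
    using scale_sym by blast
  thus "scale_dist R Y x y = scale_dist R Y y x" by (simp add: scale_dist_def)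
next
  fix x y assume xy: "x \<in> Y" "y \<in> Y"
  show "scale_dist R Y x y = 0 \<longleftrightarrow> x = y"
  proof
    assume "scale_dist R Y x y = 0"
    thus "x = y" using scale_separated[OF xy] scale_dist_lessD[OF xy] by simp
  next
    assume "x = y"
    hence "scale_dist R Y x y \<le> r" if "0 < r" for r
      using scale_dist_le that xy scale_refl by blast
    thus "scale_dist R Y x y = 0" using scale_dist_nonneg[of x y] by (meson dense_ge order_antisym)
  qed
next
  fix x y z assume xyz: "x \<in> Y" "y \<in> Y" "z \<in> Y"
  show "scale_dist R Y x z \<le> scale_dist R Y x y + scale_dist R Y y z"
  proof (rule field_le_epsilon)
    fix e :: real assume e: "0 < e"
    obtain r s where "0 < r" "r < scale_dist R Y x y + e/2" "R r x y"
      "0 < s" "s < scale_dist R Y y z + e/2" "R s y z"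
      using scale_dist_less[OF xyz(1,2), of "scale_dist R Y x y + e/2"]
        scale_dist_less[OF xyz(2,3), of "scale_dist R Y y z + e/2"] e
      by (metis less_add_same_cancel1 half_gt_zero)
    thus "scale_dist R Y x z \<le> scale_dist R Y x y + scale_dist R Y y z + e"
      using scale_dist_le[of "r + s" x z] scale_add[of r s x y z] xyz by linarith
  qed
qed

end

section \<open>Homotopies of chains\<close>

abbreviation homotopic :: "'a set \<Rightarrow> 'a rel \<Rightarrow> 'a list \<Rightarrow> 'a list \<Rightarrow> bool" where
  "homotopic S E c c' \<equiv> (c, c') \<in> (insertion_step S E \<union> (insertion_step S E)\<inverse>)\<^sup>*"

lemma homotopic_sym: "homotopic S E c c' \<Longrightarrow> homotopic S E c' c"
  by (meson sym_Un_converse sym_rtrancl symD)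

lemma homotopic_trans: "homotopic S E a b \<Longrightarrow> homotopic S E b c \<Longrightarrow> homotopic S E a c"
  by (rule rtrancl_trans)

lemma mem_chain_class: "c' \<in> chain_class S E c \<longleftrightarrow> homotopic S E c c'"
  by (simp add: chain_class_def)

lemma chain_class_eq_iff: "chain_class S E c = chain_class S E c' \<longleftrightarrow> homotopic S E c c'"
  unfolding chain_class_def using homotopic_sym homotopic_trans by blast

lemma homotopic_invariants:
  assumes "homotopic S E c c'" "is_chain S E c"
  shows "is_chain S E c' \<and> hd c' = hd c \<and> last c' = last c"
  using assms by (induction rule: rtrancl_induct) (auto simp: insertion_step_def)

lemma is_chain_append:
  assumes "us \<noteq> []" "vs \<noteq> []"
  shows "is_chain S E (us @ vs) \<longleftrightarrow>
           is_chain S E us \<and> is_chain S E vs \<and> (last us, hd vs) \<in> E"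
  using assms by (auto simp: is_chain_def successively_append_iff)

lemma is_chain_singleton: "is_chain S E [x] \<longleftrightarrow> x \<in> S"
  by (simp add: is_chain_def)

lemma is_chain_Cons: "c \<noteq> [] \<Longrightarrow> is_chain S E (x # c) \<longleftrightarrow> x \<in> S \<and> (x, hd c) \<in> E \<and> is_chain S E c"
  by (auto simp: is_chain_def successively_Cons)

lemma is_chain_snoc:
  assumes "tolerance S E" "c \<noteq> []"
  shows "is_chain S E (c @ [x]) \<longleftrightarrow> is_chain S E c \<and> (last c, x) \<in> E"
  using assms by (auto simp: is_chain_append is_chain_singleton dest: toleranceD)

lemma is_chain_not_Nil: "is_chain S E c \<Longrightarrow> c \<noteq> []"
  by (simp add: is_chain_def)

lemma is_chain_endpoints: "is_chain S E c \<Longrightarrow> hd c \<in> S \<and> last c \<in> S"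
  unfolding is_chain_def by (meson hd_in_set last_in_set subsetD)

lemma is_chain_replace:
  assumes "is_chain S E (us @ c @ vs)" "is_chain S E c" "is_chain S E c'"
    "hd c' = hd c" "last c' = last c"
  shows "is_chain S E (us @ c' @ vs)"
  using assms by (auto simp: is_chain_def successively_append_iff)

text \<open>
  A homotopy keeps the first and last vertex, so it can be carried out inside a longer chain.
\<close>

lemma homotopic_context:
  assumes "homotopic S E c c'" "is_chain S E c" "is_chain S E (us @ c @ vs)"
  shows "homotopic S E (us @ c @ vs) (us @ c' @ vs)"
  using assms(1)
proof (induction rule: rtrancl_induct)
  case (step a b)
  have a: "is_chain S E a" "hd a = hd c" "last a = last c"
    using homotopic_invariants[OF step(1) assms(2)] by auto
  have b: "is_chain S E b" "hd b = hd c" "last b = last c"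
    using homotopic_invariants[OF rtrancl_into_rtrancl[OF step(1,2)] assms(2)] by auto
  have ends: "hd (us @ a @ vs) = hd (us @ b @ vs)" "last (us @ a @ vs) = last (us @ b @ vs)"
    using a b is_chain_not_Nil[OF a(1)] is_chain_not_Nil[OF b(1)] by (auto simp: hd_append last_append)
  have chains: "is_chain S E (us @ a @ vs)" "is_chain S E (us @ b @ vs)"
    using is_chain_replace[OF assms(3,2)] a b by auto
  have *: "(us @ u @ vs, us @ v @ vs) \<in> insertion_step S E"
    if uv: "(u, v) \<in> insertion_step S E" "is_chain S E (us @ u @ vs)" "is_chain S E (us @ v @ vs)"
      "hd (us @ u @ vs) = hd (us @ v @ vs)" "last (us @ u @ vs) = last (us @ v @ vs)" for u v
  proof -
    obtain xs z ys where "u = xs @ ys" "v = xs @ z # ys"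
      using uv(1) by (auto simp: insertion_step_def)
    hence "\<exists>xs z ys. us @ u @ vs = xs @ ys \<and> us @ v @ vs = xs @ z # ys"
      by (intro exI[of _ "us @ xs"] exI[of _ z] exI[of _ "ys @ vs"]) auto
    thus ?thesis using uv unfolding insertion_step_def by simp
  qed
  have "(us @ a @ vs, us @ b @ vs) \<in> insertion_step S E \<union> (insertion_step S E)\<inverse>"
    using step(2) *[OF _ chains ends] *[OF _ chains(2,1) ends[symmetric]] by blast
  thus ?case using step(3) by (rule rtrancl_into_rtrancl[rotated])
qed simp

text \<open>
  With vertices on both sides of the new one, the endpoints cannot change.
\<close>

lemma homotopic_insert:
  assumes "is_chain S E (us @ vs)" "is_chain S E (us @ z # vs)" "us \<noteq> []" "vs \<noteq> []"
  shows "homotopic S E (us @ vs) (us @ z # vs)"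
  using assms by (intro r_into_rtrancl UnI1) (auto simp: insertion_step_def)

lemma homotopic_double:
  assumes "tolerance S E" "is_chain S E [x]"
  shows "homotopic S E [x] [x, x]"
proof -
  have "is_chain S E [x, x]"
    using assms by (auto simp: is_chain_Cons is_chain_singleton dest: toleranceD)
  moreover have "\<exists>xs z ys. [x] = xs @ ys \<and> [x, x] = xs @ z # ys"
    by (intro exI[of _ "[x]"] exI[of _ x] exI[of _ "[]"]) simp
  ultimately have "([x], [x, x]) \<in> insertion_step S E"
    using assms(2) by (simp add: insertion_step_def)
  thus ?thesis by blast
qed

lemma homotopic_repeat:
  assumes "tolerance S E" "is_chain S E (us @ x # vs)"
  shows "homotopic S E (us @ x # vs) (us @ x # x # vs)"
proof -
  have "is_chain S E [x]" using assms(2) by (simp add: is_chain_def)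
  thus ?thesis
    using homotopic_context[OF homotopic_double[OF assms(1)], of x us vs] assms(2) by simp
qed

lemma homotopic_mono:
  assumes "homotopic S D c c'" "D \<subseteq> E"
  shows "homotopic S E c c'"
proof -
  have "is_chain S D c \<Longrightarrow> is_chain S E c" for c
    using assms(2) unfolding is_chain_def by (auto intro: successively_mono)
  hence "insertion_step S D \<subseteq> insertion_step S E" unfolding insertion_step_def by auto
  thus ?thesis using assms(1) rtrancl_mono[of "insertion_step S D \<union> (insertion_step S D)\<inverse>"
      "insertion_step S E \<union> (insertion_step S E)\<inverse>"] by blast
qed

lemma is_chain_mono: "is_chain S D c \<Longrightarrow> D \<subseteq> E \<Longrightarrow> is_chain S E c"
  unfolding is_chain_def by (auto intro: successively_mono)

lemma is_chain_rev: "tolerance S E \<Longrightarrow> is_chain S E (rev c) \<longleftrightarrow> is_chain S E c"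
  unfolding is_chain_def by (auto intro: successively_mono dest: toleranceD)

lemma homotopic_rev:
  assumes "tolerance S E" "homotopic S E c c'" 
  shows "homotopic S E (rev c) (rev c')"
proof -
  have "(rev a, rev b) \<in> insertion_step S E" if ab: "(a, b) \<in> insertion_step S E" for a b
  proof -
    obtain xs z ys where "a = xs @ ys" "b = xs @ z # ys"
      using ab by (auto simp: insertion_step_def)
    hence "\<exists>xs z ys. rev a = xs @ ys \<and> rev b = xs @ z # ys"
      by (intro exI[of _ "rev ys"] exI[of _ z] exI[of _ "rev xs"]) auto
    thus ?thesis using ab assms(1)
      by (auto simp: insertion_step_def is_chain_rev hd_rev last_rev)
  qed
  with assms(2) show ?thesis
    by (induction rule: rtrancl_induct) (auto intro: rtrancl_into_rtrancl)
qed

text \<open>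
  The concatenation of chains \<open>a\<close>, \<open>b\<close> with \<open>last a = hd b\<close> is \<open>a @ tl b\<close>, and also
  \<open>butlast a @ b\<close>. Each form leaves one of the factors intact.
\<close>

lemma concat_eq:
  assumes "a \<noteq> []" "b \<noteq> []" "last a = hd b"
  shows "a @ tl b = butlast a @ b"
  using assms by (metis append_assoc append_Cons append_Nil append_butlast_last_id list.collapse)

lemma concat_chain:
  assumes "is_chain S E a" "is_chain S E b" "last a = hd b"
  shows "is_chain S E (a @ tl b)" "hd (a @ tl b) = hd a" "last (a @ tl b) = last b"
proof -
  have ne: "a \<noteq> []" "b \<noteq> []" using assms by (auto dest: is_chain_not_Nil)
  show "hd (a @ tl b) = hd a" using ne by simp
  show "last (a @ tl b) = last b" unfolding concat_eq[OF ne assms(3)] using ne by simp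
  show "is_chain S E (a @ tl b)"
  proof (cases "tl b")
    case (Cons v vs)
    hence "b = hd b # v # vs" using ne by (metis list.collapse)
    hence "is_chain S E (v # vs)" "(last a, v) \<in> E"
      using assms(2,3) is_chain_Cons[of "v # vs" S E "hd b"] by auto
    thus ?thesis using is_chain_append[of a "v # vs"] ne assms(1) Cons by simp
  qed (use assms in simp)
qed

lemma homotopic_concat:
  assumes "is_chain S E a" "is_chain S E b" "last a = hd b"
    and "homotopic S E a a'" "homotopic S E b b'"
  shows "homotopic S E (a @ tl b) (a' @ tl b')"
proof -
  have a': "is_chain S E a'" "last a' = hd b"
    using homotopic_invariants[OF assms(4,1)] assms(3) by auto
  have b': "is_chain S E b'" "hd b' = hd b"
    using homotopic_invariants[OF assms(5,2)] by auto
  have "homotopic S E (a @ tl b) (a' @ tl b)"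
    using homotopic_context[OF assms(4,1), of "[]" "tl b"] concat_chain[OF assms(1-3)] by simp
  also have "homotopic S E (a' @ tl b) (a' @ tl b')"
    using homotopic_context[OF assms(5,2), of "butlast a'" "[]"]
      concat_chain[OF a'(1) assms(2) a'(2)] concat_eq[of a' b] concat_eq[of a' b']
      a' b' assms(2) by (simp add: is_chain_not_Nil)
  finally (homotopic_trans) show ?thesis .
qed

text \<open>
  A chain followed by its reverse is contracted from its turning point outwards: once the part
  beyond the first edge is contracted, the spike that is left collapses to its foot.
\<close>

lemma homotopic_backtrack:
  assumes "tolerance S E" "is_chain S E c"
  shows "homotopic S E (c @ tl (rev c)) [hd c]"
  using assms(2)
proof (induction c)
  case (Cons x c)
  show ?case
  proof (cases "c = []")
    case False
    have c: "x \<in> S" "(x, hd c) \<in> E" "is_chain S E c"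
      using Cons.prems False is_chain_Cons[of c S E x] by auto
    have loop: "is_chain S E (c @ tl (rev c))"
      using concat_chain[of S E c "rev c"] c assms(1) by (simp add: is_chain_rev hd_rev)
    have xx: "is_chain S E ([x] @ (c @ tl (rev c)) @ [x])"
      using concat_chain(1)[of S E "x # c" "rev (x # c)"] Cons.prems assms(1) False
        is_chain_rev[OF assms(1), of "x # c"] by (simp add: hd_rev)
    have xhx: "is_chain S E [x, hd c, x]" "is_chain S E [x, x]" "is_chain S E [x]"
      using c assms(1) by (auto simp: is_chain_Cons is_chain_singleton dest: toleranceD)
    have "homotopic S E ([x] @ (c @ tl (rev c)) @ [x]) ([x] @ [hd c] @ [x])"
      using homotopic_context[OF Cons.IH[OF c(3)] loop xx] .
    also have "homotopic S E ([x] @ [hd c] @ [x]) [x, x]"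
      using homotopic_sym[OF homotopic_insert[of S E "[x]" "[x]" "hd c"]] xhx by simp
    also have "homotopic S E [x, x] [x]"
      using homotopic_sym[OF homotopic_double[OF assms(1) xhx(3)]] .
    finally (homotopic_trans) show ?thesis using False by simp
  qed simp
qed (simp add: is_chain_def)

section \<open>The spaces of homotopy classes\<close>

lemma chain_space_iff:
  "a \<in> chain_space S p E \<longleftrightarrow> (\<exists>c. is_chain S E c \<and> hd c = p \<and> a = chain_class S E c)"
  by (auto simp: chain_space_def)

lemma chain_space_E:
  assumes "a \<in> chain_space S p E"
  obtains c where "is_chain S E c" "hd c = p" "a = chain_class S E c"
  using assms by (auto simp: chain_space_iff)

lemma endpoint_class:
  assumes "is_chain S E c"
  shows "endpoint (chain_class S E c) = last c"
proof -
  have "last c' = last c" if "c' \<in> chain_class S E c" for c'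
    using homotopic_invariants[OF _ assms] that unfolding mem_chain_class by blast
  moreover have "c \<in> chain_class S E c" by (simp add: mem_chain_class)
  ultimately have "last ` chain_class S E c = {last c}" by blast
  thus ?thesis by (simp add: endpoint_def)
qed

lemma endpoint_in: "a \<in> chain_space S p E \<Longrightarrow> endpoint a \<in> S"
  by (auto elim!: chain_space_E simp: endpoint_class is_chain_endpoints)

lemma base_class_in: "p \<in> S \<Longrightarrow> chain_class S E [p] \<in> chain_space S p E"
  unfolding chain_space_iff by (intro exI[of _ "[p]"]) (simp add: is_chain_singleton)

lemma chain_bond_class:
  assumes "D \<subseteq> E"
  shows "chain_bond S E D (chain_class S D c) = chain_class S E c"
proof -
  have "chain_class S E c' = chain_class S E c" if "c' \<in> chain_class S D c" for c'
    using homotopic_sym[OF homotopic_mono[OF _ assms]] that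
    unfolding mem_chain_class chain_class_eq_iff by blast
  moreover have "c \<in> chain_class S D c" by (simp add: mem_chain_class)
  ultimately show ?thesis unfolding chain_bond_def by blast
qed

lemma chain_bond_in:
  assumes "D \<subseteq> E" "a \<in> chain_space S p D"
  shows "chain_bond S E D a \<in> chain_space S p E"
  using assms by (auto elim!: chain_space_E simp: chain_bond_class chain_space_iff intro: is_chain_mono)

lemma endpoint_chain_bond:
  assumes "D \<subseteq> E" "a \<in> chain_space S p D"
  shows "endpoint (chain_bond S E D a) = endpoint a"
  using assms is_chain_mono[OF _ assms(1)]
  by (auto elim!: chain_space_E simp: chain_bond_class endpoint_class)

lemma chain_bond_id: "a \<in> chain_space S p E \<Longrightarrow> chain_bond S E E a = a"
  by (auto elim!: chain_space_E simp: chain_bond_class)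

lemma chain_bond_comp:
  assumes "D \<subseteq> E" "F \<subseteq> D" "a \<in> chain_space S p F"
  shows "chain_bond S E D (chain_bond S D F a) = chain_bond S E F a"
proof -
  have "F \<subseteq> E" using assms by blast
  thus ?thesis using assms by (auto elim!: chain_space_E simp: chain_bond_class)
qed

text \<open>
  The relation \<open>D\<^sup>*\<close> says that the second class arises from the first by one more step in \<open>D\<close>,
  whichever representative of the first class is chosen.
\<close>

lemma lift_class_iff:
  assumes E: "tolerance S E" and D: "tolerance S D" "D \<subseteq> E"
    and c: "is_chain S E c" "hd c = p"
  shows "(chain_class S E c, b) \<in> lift_entourage S p E D \<longleftrightarrow>
           (\<exists>z. (last c, z) \<in> D \<and> b = chain_class S E (c @ [z]))"
proof
  assume "(chain_class S E c, b) \<in> lift_entourage S p E D"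
  then obtain xs y z where xs: "xs \<noteq> []" "hd xs = p" "is_chain S E (xs @ [y])"
      "is_chain S E (xs @ [z])" "(y, z) \<in> D" and
    eq: "chain_class S E c = chain_class S E (xs @ [y])" "b = chain_class S E (xs @ [z])"
    unfolding lift_entourage_def by blast
  have h: "homotopic S E (xs @ [y]) c" using eq(1) by (metis chain_class_eq_iff)
  have "last c = y" using homotopic_invariants[OF h xs(3)] by simp
  have yz: "is_chain S E (xs @ [y] @ [z])"
    using is_chain_snoc[OF E, of "xs @ [y]" z] xs D(2) by auto
  have "homotopic S E (xs @ [z]) (xs @ [y, z])"
    using homotopic_insert[of S E xs "[z]" y] xs yz by simp
  also have "homotopic S E (xs @ [y, z]) (c @ [z])"
    using homotopic_context[OF h xs(3), of "[]" "[z]"] yz by simp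
  finally (homotopic_trans) have "b = chain_class S E (c @ [z])"
    using eq(2) chain_class_eq_iff by metis
  thus "\<exists>z. (last c, z) \<in> D \<and> b = chain_class S E (c @ [z])"
    using \<open>last c = y\<close> xs(5) by blast
next
  assume "\<exists>z. (last c, z) \<in> D \<and> b = chain_class S E (c @ [z])"
  then obtain z where z: "(last c, z) \<in> D" "b = chain_class S E (c @ [z])" by blast
  have c0: "c \<noteq> []" using c(1) by (rule is_chain_not_Nil)
  have cc: "c = butlast c @ [last c]" using c0 by simp
  have "homotopic S E c (c @ [last c])"
    using homotopic_repeat[OF E, of "butlast c" "last c" "[]"] c(1) c0 cc
    by (metis append.assoc append_Cons append_Nil)
  hence "chain_class S E c = chain_class S E (c @ [last c])" by (simp add: chain_class_eq_iff)
  moreover have "is_chain S E (c @ [last c])" "is_chain S E (c @ [z])"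
    using is_chain_snoc[OF E c0] c(1) toleranceD[OF E] is_chain_endpoints[OF c(1)] z(1) D(2) by auto
  ultimately show "(chain_class S E c, b) \<in> lift_entourage S p E D"
    unfolding lift_entourage_def using c0 c(2) z by blast
qed

lemma lift_mono: "D \<subseteq> D' \<Longrightarrow> lift_entourage S p E D \<subseteq> lift_entourage S p E D'"
  unfolding lift_entourage_def by blast

lemma lift_in_space:
  assumes "(a, b) \<in> lift_entourage S p E D"
  shows "a \<in> chain_space S p E" "b \<in> chain_space S p E"
proof -
  obtain xs y z where *: "xs \<noteq> []" "hd xs = p" "is_chain S E (xs @ [y])" "is_chain S E (xs @ [z])"
    "a = chain_class S E (xs @ [y])" "b = chain_class S E (xs @ [z])"
    using assms unfolding lift_entourage_def by blast
  thus "a \<in> chain_space S p E" "b \<in> chain_space S p E"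
    unfolding chain_space_iff by (metis hd_append2)+
qed

lemma endpoint_lift:
  assumes "(a, b) \<in> lift_entourage S p E D"
  shows "(endpoint a, endpoint b) \<in> D"
  using assms unfolding lift_entourage_def by (auto simp: endpoint_class)

lemma lift_refl:
  assumes "tolerance S E" "tolerance S D" "D \<subseteq> E" "a \<in> chain_space S p E"
  shows "(a, a) \<in> lift_entourage S p E D"
proof -
  obtain c where c: "is_chain S E c" "hd c = p" "a = chain_class S E c"
    using assms(4) by (rule chain_space_E)
  have "c \<noteq> []" using c(1) by (rule is_chain_not_Nil)
  hence "homotopic S E c (c @ [last c])"
    using homotopic_repeat[OF assms(1), of "butlast c" "last c" "[]"] c(1)
    by (metis append.assoc append_Cons append_Nil append_butlast_last_id)
  moreover have "(last c, last c) \<in> D"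
    using is_chain_endpoints[OF c(1)] toleranceD[OF assms(2)] by blast
  ultimately show ?thesis
    using lift_class_iff[OF assms(1-3) c(1,2)] c(3) chain_class_eq_iff by metis
qed

lemma lift_sym:
  assumes "tolerance S D" "(a, b) \<in> lift_entourage S p E D"
  shows "(b, a) \<in> lift_entourage S p E D"
  using assms toleranceD(3)[OF assms(1)] unfolding lift_entourage_def by blast

text \<open>
  Two consecutive steps are homotopic to one step as soon as the resulting edge belongs to \<open>E\<close>,
  since then the intermediate vertex can be removed.
\<close>

lemma lift_trans:
  assumes E: "tolerance S E" and D: "tolerance S D" "D \<subseteq> E" and D': "tolerance S D'" "D' \<subseteq> E"
    and F: "tolerance S F" "F \<subseteq> E"
    and ab: "(a, b) \<in> lift_entourage S p E D" and bc: "(b, c) \<in> lift_entourage S p E D'"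
    and ac: "(endpoint a, endpoint c) \<in> F"
  shows "(a, c) \<in> lift_entourage S p E F"
proof -
  obtain l where l: "is_chain S E l" "hd l = p" "a = chain_class S E l"
    using lift_in_space[OF ab] by (rule_tac chain_space_E)
  have l0: "l \<noteq> []" using l(1) by (rule is_chain_not_Nil)
  obtain y where y: "(last l, y) \<in> D" "b = chain_class S E (l @ [y])"
    using ab unfolding l(3) lift_class_iff[OF E D l(1,2)] by blast
  have ly: "is_chain S E (l @ [y])" "hd (l @ [y]) = p"
    using is_chain_snoc[OF E l0] l y D(2) l0 by auto
  obtain z where z: "(y, z) \<in> D'" "c = chain_class S E ((l @ [y]) @ [z])"
    using bc unfolding y(2) lift_class_iff[OF E D' ly] by auto
  have lyz: "is_chain S E ((l @ [y]) @ [z])"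
    using is_chain_snoc[OF E, of "l @ [y]" z] ly z D'(2) by auto
  have lz: "(last l, z) \<in> F" using ac endpoint_class[OF lyz] endpoint_class[OF l(1)] l(3) z(2) by simp
  hence "is_chain S E (l @ [z])" using is_chain_snoc[OF E l0] l F(2) by auto
  hence "homotopic S E (l @ [z]) (l @ y # [z])" using lyz l0 by (intro homotopic_insert) auto
  hence "c = chain_class S E (l @ [z])" using z(2) by (simp add: chain_class_eq_iff[symmetric])
  thus ?thesis unfolding l(3) lift_class_iff[OF E F l(1,2)] using lz by blast
qed

text \<open>
  Distinct points of a fibre of the endpoint map are never \<open>D\<^sup>*\<close>-close: the prolonging steps end
  in the same vertex. Both the separation of points in the limit and the discreteness of the action
  of the loops rest on this.
\<close>

lemma lift_same_endpoint:
  assumes "(a, b) \<in> lift_entourage S p E D" "endpoint a = endpoint b"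
  shows "a = b"
  using assms unfolding lift_entourage_def by (auto simp: endpoint_class)

lemma lift_chain_bond:
  assumes "tolerance S E" "tolerance S D" "tolerance S F" "F \<subseteq> D" "D \<subseteq> E"
    and ab: "(a, b) \<in> lift_entourage S p D F"
  shows "(chain_bond S E D a, chain_bond S E D b) \<in> lift_entourage S p E F"
proof -
  obtain c where c: "is_chain S D c" "hd c = p" "a = chain_class S D c"
    using lift_in_space[OF ab] by (rule_tac chain_space_E)
  obtain z where "(last c, z) \<in> F" "b = chain_class S D (c @ [z])"
    using ab unfolding c(3) lift_class_iff[OF assms(2,3,4) c(1,2)] by blast
  moreover have "is_chain S E c" using c(1) assms(5) by (rule is_chain_mono)
  ultimately show ?thesis
    using lift_class_iff[OF assms(1,3) _ _ c(2)] c assms(4,5) by (auto simp: chain_bond_class)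
qed

lemma eventually_chain_uniformity:
  assumes "E \<in> entourages S U"
  shows "eventually P (chain_uniformity S p U E) \<longleftrightarrow>
           (\<exists>D\<in>entourages S U. D \<subseteq> E \<and> (\<forall>q\<in>lift_entourage S p E D. P q))"
proof -
  have "eventually P (chain_uniformity S p U E) \<longleftrightarrow>
      (\<exists>D\<in>{D \<in> entourages S U. D \<subseteq> E}. eventually P (principal (lift_entourage S p E D)))"
    unfolding chain_uniformity_def
  proof (rule eventually_INF_base)
    fix A B assume "A \<in> {D \<in> entourages S U. D \<subseteq> E}" "B \<in> {D \<in> entourages S U. D \<subseteq> E}"
    thus "\<exists>x\<in>{D \<in> entourages S U. D \<subseteq> E}. principal (lift_entourage S p E x)
        \<le> inf (principal (lift_entourage S p E A)) (principal (lift_entourage S p E B))"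
      using entourages_Int[of A S U B] lift_mono[of "A \<inter> B" A S p E] lift_mono[of "A \<inter> B" B S p E]
      by (intro bexI[of _ "A \<inter> B"]) auto
  qed (use assms in blast)
  thus ?thesis by (auto simp: eventually_principal)
qed

lemma uniform_space_on_chain_space:
  assumes U: "uniform_space_on S U" and E: "E \<in> entourages S U"
  shows "uniform_space_on (chain_space S p E) (chain_uniformity S p U E)"
proof -
  note ev = eventually_chain_uniformity[OF E]
  note tol = entourages_tolerance[OF U]
  have "chain_uniformity S p U E \<le> principal (chain_space S p E \<times> chain_space S p E)"
    unfolding le_principal ev using E lift_in_space[of _ _ S p E E] by (intro bexI[of _ E]) auto
  moreover have "P (a, a)"
    if P: "eventually P (chain_uniformity S p U E)" and a: "a \<in> chain_space S p E" for P a
  proof -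
    obtain D where "D \<in> entourages S U" "D \<subseteq> E" "\<forall>q\<in>lift_entourage S p E D. P q"
      using P[unfolded ev] by blast
    thus ?thesis using lift_refl[OF tol tol _ a] E by blast
  qed
  moreover have "\<forall>\<^sub>F (a, b) in chain_uniformity S p U E. P (b, a)"
    if P: "eventually P (chain_uniformity S p U E)" for P
  proof -
    obtain D where "D \<in> entourages S U" "D \<subseteq> E" "\<forall>q\<in>lift_entourage S p E D. P q"
      using P[unfolded ev] by blast
    thus ?thesis unfolding ev using lift_sym[OF tol[of D]] by (intro bexI[of _ D]) auto
  qed
  moreover have "\<exists>Q. eventually Q (chain_uniformity S p U E) \<and>
      (\<forall>a b c. Q (a, b) \<longrightarrow> Q (b, c) \<longrightarrow> P (a, c))"
    if P: "eventually P (chain_uniformity S p U E)" for P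
  proof -
    obtain D where D: "D \<in> entourages S U" "D \<subseteq> E" "\<forall>q\<in>lift_entourage S p E D. P q"
      using P[unfolded ev] by blast
    obtain F where F: "F \<in> entourages S U" "F \<subseteq> D"
      "\<And>x y z. (x, y) \<in> F \<Longrightarrow> (y, z) \<in> F \<Longrightarrow> (x, z) \<in> D"
      by (rule entourages_halving[OF U D(1)]) blast
    have FE: "F \<subseteq> E" using F(2) D(2) by blast
    have "(a, c) \<in> lift_entourage S p E D"
      if "(a, b) \<in> lift_entourage S p E F" "(b, c) \<in> lift_entourage S p E F" for a b c
      using lift_trans[OF tol[OF E] tol[OF F(1)] FE tol[OF F(1)] FE tol[OF D(1)] D(2) that]
        F(3) endpoint_lift[OF that(1)] endpoint_lift[OF that(2)] by blast
    thus ?thesis using D(3) F(1) FE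
      by (intro exI[of _ "\<lambda>q. q \<in> lift_entourage S p E F"]) (auto simp: ev)
  qed
  ultimately show ?thesis unfolding uniform_space_on_def by blast
qed

text \<open>
  Both uniformities are described by the same entourages \<open>D\<close>, so the endpoint map is a uniform
  homeomorphism as soon as it is bijective.
\<close>

lemma uniform_homeomorphism_endpoint:
  assumes U: "uniform_space_on S U" and E: "E \<in> entourages S U"
    and bij: "bij_betw endpoint (chain_space S p E) S"
  shows "uniform_homeomorphism (chain_space S p E) (chain_uniformity S p U E) S U endpoint"
proof -
  note tol = entourages_tolerance[OF U]
  let ?i = "inv_into (chain_space S p E) endpoint"
  have "filterlim (\<lambda>(a, b). (endpoint a, endpoint b)) U (chain_uniformity S p U E)"
    unfolding filterlim_iff eventually_chain_uniformity[OF E]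
  proof (intro allI impI)
    fix P assume "eventually P U"
    then obtain D where D: "D \<in> entourages S U" "\<forall>q\<in>D. P q"
      using eventually_uniformity_iff_entourage[OF U] by metis
    have "P (endpoint a, endpoint b)" if "(a, b) \<in> lift_entourage S p E (D \<inter> E)" for a b
      using D(2) endpoint_lift[OF that] by blast
    thus "\<exists>D\<in>entourages S U. D \<subseteq> E \<and>
        (\<forall>q\<in>lift_entourage S p E D. P (case q of (a, b) \<Rightarrow> (endpoint a, endpoint b)))"
      using entourages_Int[OF D(1) E] by (intro bexI[of _ "D \<inter> E"]) auto
  qed
  moreover have "filterlim (\<lambda>(x, y). (?i x, ?i y)) (chain_uniformity S p U E) U"
    unfolding chain_uniformity_def filterlim_INF filterlim_principal
  proof
    fix D assume D: "D \<in> {D \<in> entourages S U. D \<subseteq> E}"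
    have "(?i x, ?i y) \<in> lift_entourage S p E D" if xy: "(x, y) \<in> D" for x y
    proof -
      have S: "x \<in> S" "y \<in> S" using toleranceD(1,2)[OF tol] D xy by blast+
      have "?i x \<in> chain_space S p E" using S bij by (metis bij_betw_imp_surj_on inv_into_into)
      then obtain c where c: "is_chain S E c" "hd c = p" "?i x = chain_class S E c"
        by (rule chain_space_E)
      have cx: "last c = x"
        using S bij c endpoint_class[OF c(1)] by (metis bij_betw_inv_into_right)
      have c0: "c \<noteq> []" using c(1) by (rule is_chain_not_Nil)
      have cy: "is_chain S E (c @ [y])"
        using is_chain_snoc[OF tol[OF E] c0] c(1) cx xy D by auto
      hence "chain_class S E (c @ [y]) \<in> chain_space S p E"
        using c0 c(2) unfolding chain_space_iff by (metis hd_append2)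
      hence "?i y = chain_class S E (c @ [y])"
        using bij endpoint_class[OF cy] by (metis bij_betw_inv_into_left last_snoc)
      moreover have "tolerance S D" "D \<subseteq> E" using D tol by auto
      ultimately show ?thesis
        using lift_class_iff[OF tol[OF E] _ _ c(1,2), of D "?i y"] c(3) cx xy by auto
    qed
    hence "\<forall>q\<in>D. (case q of (x, y) \<Rightarrow> (?i x, ?i y)) \<in> lift_entourage S p E D" by auto
    thus "\<forall>\<^sub>F q in U. (case q of (x, y) \<Rightarrow> (?i x, ?i y)) \<in> lift_entourage S p E D"
      using D unfolding eventually_uniformity_iff_entourage[OF U] by (intro bexI[of _ D]) auto
  qed
  moreover have "?i \<in> S \<rightarrow> chain_space S p E"
    using bij by (metis Pi_I bij_betw_imp_surj_on inv_into_into)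
  ultimately show ?thesis
    using bij unfolding uniform_homeomorphism_def uniformly_continuous_between_def
    by (auto dest: bij_betw_imp_funcset)
qed

section \<open>Translation of classes by loops\<close>

text \<open>
  The formula of the product of loops, now also with a class of chains as its second factor.
\<close>

definition concat_class :: "'a set \<Rightarrow> 'a rel \<Rightarrow> 'a list set \<Rightarrow> 'a list set \<Rightarrow> 'a list set" where
  "concat_class S E A B = (\<Union>a\<in>A. \<Union>b\<in>B. chain_class S E (a @ tl b))"

lemma mult_loop_group: "mult (loop_group S p E) = concat_class S E"
  by (simp add: loop_group_def concat_class_def fun_eq_iff)

lemma one_loop_group: "one (loop_group S p E) = chain_class S E [p]"
  by (simp add: loop_group_def)

lemma carrier_loop_group: "carrier (loop_group S p E) = {a \<in> chain_space S p E. endpoint a = p}"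
  by (auto simp: loop_group_def chain_space_iff endpoint_class)

lemma loop_E:
  assumes "g \<in> carrier (loop_group S p E)"
  obtains l where "is_chain S E l" "hd l = p" "last l = p" "g = chain_class S E l"
  using assms by (auto simp: loop_group_def)

lemma concat_class_eq:
  assumes "is_chain S E a" "is_chain S E b" "last a = hd b"
  shows "concat_class S E (chain_class S E a) (chain_class S E b) = chain_class S E (a @ tl b)"
proof -
  have "chain_class S E (a' @ tl b') = chain_class S E (a @ tl b)"
    if "a' \<in> chain_class S E a" "b' \<in> chain_class S E b" for a' b'
    using homotopic_sym[OF homotopic_concat[OF assms]] that
    unfolding mem_chain_class chain_class_eq_iff by blast
  moreover have "a \<in> chain_class S E a" "b \<in> chain_class S E b" by (simp_all add: mem_chain_class)
  ultimately show ?thesis unfolding concat_class_def by blast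
qed

lemma concat_class_in:
  assumes "g \<in> carrier (loop_group S p E)" "a \<in> chain_space S p E"
  shows "concat_class S E g a \<in> chain_space S p E" "endpoint (concat_class S E g a) = endpoint a"
proof -
  obtain l where l: "is_chain S E l" "hd l = p" "last l = p" "g = chain_class S E l"
    using assms(1) by (rule loop_E)
  obtain c where c: "is_chain S E c" "hd c = p" "a = chain_class S E c"
    using assms(2) by (rule chain_space_E)
  have lc: "last l = hd c" using l c by simp
  have eq: "concat_class S E g a = chain_class S E (l @ tl c)"
    using concat_class_eq[OF l(1) c(1) lc] l(4) c(3) by simp
  note k = concat_chain[OF l(1) c(1) lc]
  show "concat_class S E g a \<in> chain_space S p E"
    unfolding eq chain_space_iff using k(1,2) l(2) by blast
  show "endpoint (concat_class S E g a) = endpoint a"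
    unfolding eq by (simp add: endpoint_class[OF k(1)] k(3) c(3) endpoint_class[OF c(1)])
qed

lemma concat_class_assoc:
  assumes "g \<in> carrier (loop_group S p E)" "h \<in> carrier (loop_group S p E)" "a \<in> chain_space S p E"
  shows "concat_class S E (concat_class S E g h) a = concat_class S E g (concat_class S E h a)"
proof -
  obtain l where l: "is_chain S E l" "hd l = p" "last l = p" "g = chain_class S E l"
    using assms(1) by (rule loop_E)
  obtain m where m: "is_chain S E m" "hd m = p" "last m = p" "h = chain_class S E m"
    using assms(2) by (rule loop_E)
  obtain c where c: "is_chain S E c" "hd c = p" "a = chain_class S E c"
    using assms(3) by (rule chain_space_E)
  have lm: "last l = hd m" and mc: "last m = hd c" using l m c by simp_all
  note LM = concat_chain[OF l(1) m(1) lm] and MC = concat_chain[OF m(1) c(1) mc]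
  have "concat_class S E (concat_class S E g h) a = chain_class S E ((l @ tl m) @ tl c)"
    using concat_class_eq[OF l(1) m(1) lm] concat_class_eq[OF LM(1) c(1)] LM(3) mc l m c by simp
  moreover have "concat_class S E g (concat_class S E h a) = chain_class S E (l @ tl (m @ tl c))"
    using concat_class_eq[OF m(1) c(1) mc] concat_class_eq[OF l(1) MC(1)] MC(2) lm l m c by simp
  moreover have "tl (m @ tl c) = tl m @ tl c" using is_chain_not_Nil[OF m(1)] by simp
  ultimately show ?thesis by simp
qed

lemma concat_class_one:
  assumes "p \<in> S" "a \<in> chain_space S p E"
  shows "concat_class S E (chain_class S E [p]) a = a"
proof -
  obtain c where c: "is_chain S E c" "hd c = p" "a = chain_class S E c"
    using assms(2) by (rule chain_space_E)
  have "[p] @ tl c = c" using is_chain_not_Nil[OF c(1)] c(2) by auto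
  moreover have "is_chain S E [p]" using assms(1) by (simp add: is_chain_singleton)
  ultimately show ?thesis using concat_class_eq[of S E "[p]" c] c by simp
qed

lemma concat_class_chain_bond:
  assumes "D \<subseteq> E" "g \<in> carrier (loop_group S p D)" "a \<in> chain_space S p D"
  shows "chain_bond S E D (concat_class S D g a) =
           concat_class S E (chain_bond S E D g) (chain_bond S E D a)"
proof -
  obtain l where l: "is_chain S D l" "hd l = p" "last l = p" "g = chain_class S D l"
    using assms(2) by (rule loop_E)
  obtain c where c: "is_chain S D c" "hd c = p" "a = chain_class S D c"
    using assms(3) by (rule chain_space_E)
  show ?thesis
    using concat_class_eq[OF l(1) c(1)] concat_class_eq[OF is_chain_mono is_chain_mono, OF l(1) assms(1) c(1) assms(1)]
      l c by (simp add: chain_bond_class[OF assms(1)])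
qed

text \<open>
  A loop is prefixed to a chain, whereas \<open>D\<^sup>*\<close> compares the ends of chains.
\<close>

lemma concat_class_lift:
  assumes "tolerance S E" "tolerance S D" "D \<subseteq> E"
    and g: "g \<in> carrier (loop_group S p E)" and ab: "(a, b) \<in> lift_entourage S p E D"
  shows "(concat_class S E g a, concat_class S E g b) \<in> lift_entourage S p E D"
proof -
  obtain l where l: "is_chain S E l" "hd l = p" "last l = p" "g = chain_class S E l"
    using g by (rule loop_E)
  obtain c where c: "is_chain S E c" "hd c = p" "a = chain_class S E c"
    using lift_in_space[OF ab] by (rule_tac chain_space_E)
  have c0: "c \<noteq> []" using c(1) by (rule is_chain_not_Nil)
  obtain z where z: "(last c, z) \<in> D" "b = chain_class S E (c @ [z])"
    using ab unfolding c(3) lift_class_iff[OF assms(1-3) c(1,2)] by blast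
  have cz: "is_chain S E (c @ [z])" using is_chain_snoc[OF assms(1) c0] c z assms(3) by auto
  have lc: "last l = hd c" "last l = hd (c @ [z])" using l c c0 by simp_all
  note k = concat_chain[OF l(1) c(1) lc(1)]
  have "concat_class S E g a = chain_class S E (l @ tl c)"
    using concat_class_eq[OF l(1) c(1) lc(1)] l c by simp
  moreover have "concat_class S E g b = chain_class S E ((l @ tl c) @ [z])"
    using concat_class_eq[OF l(1) cz lc(2)] l z c0 by simp
  moreover have "hd (l @ tl c) = p" using k(2) l(2) by simp
  ultimately show ?thesis
    using lift_class_iff[OF assms(1-3) k(1)] z(1) k(3) by auto
qed

lemma chain_bond_loop:
  assumes "D \<subseteq> E" "g \<in> carrier (loop_group S p D)"
  shows "chain_bond S E D g \<in> carrier (loop_group S p E)"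
  using assms chain_bond_in[OF assms(1)] endpoint_chain_bond[OF assms(1)]
  by (auto simp: carrier_loop_group)

text \<open>
  Two classes with the same endpoint differ by a loop, which runs along the second class and
  returns along the first.
\<close>

definition difference_loop :: "'a set \<Rightarrow> 'a rel \<Rightarrow> 'a list set \<Rightarrow> 'a list set \<Rightarrow> 'a list set" where
  "difference_loop S E A B = (\<Union>a\<in>A. \<Union>b\<in>B. chain_class S E (b @ tl (rev a)))"

lemma difference_loop_eq:
  assumes "tolerance S E" "is_chain S E a" "is_chain S E b" "last a = last b"
  shows "difference_loop S E (chain_class S E a) (chain_class S E b) = chain_class S E (b @ tl (rev a))"
proof -
  have ra: "is_chain S E (rev a)" "last b = hd (rev a)"
    using assms is_chain_not_Nil[OF assms(2)] by (simp_all add: is_chain_rev hd_rev)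
  have "chain_class S E (b' @ tl (rev a')) = chain_class S E (b @ tl (rev a))"
    if "a' \<in> chain_class S E a" "b' \<in> chain_class S E b" for a' b'
    using homotopic_sym[OF homotopic_concat[OF assms(3) ra]] homotopic_rev[OF assms(1)] that
    unfolding mem_chain_class chain_class_eq_iff by blast
  moreover have "a \<in> chain_class S E a" "b \<in> chain_class S E b" by (simp_all add: mem_chain_class)
  ultimately show ?thesis unfolding difference_loop_def by blast
qed

lemma difference_loop:
  assumes E: "tolerance S E" and ab: "a \<in> chain_space S p E" "b \<in> chain_space S p E"
    and same: "endpoint a = endpoint b"
  shows "difference_loop S E a b \<in> carrier (loop_group S p E)"
    and "concat_class S E (difference_loop S E a b) a = b"
proof -
  obtain c where c: "is_chain S E c" "hd c = p" "a = chain_class S E c"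
    using ab(1) by (rule chain_space_E)
  obtain e where e: "is_chain S E e" "hd e = p" "b = chain_class S E e"
    using ab(2) by (rule chain_space_E)
  have ce: "last c = last e" using same c e by (simp add: endpoint_class)
  have c0: "c \<noteq> []" "rev c \<noteq> []" using c(1) by (auto dest: is_chain_not_Nil)
  have rc: "is_chain S E (rev c)" "last e = hd (rev c)" "last (rev c) = p" "last (rev c) = hd c"
    using c c0 ce E by (simp_all add: is_chain_rev hd_rev last_rev)
  note k = concat_chain[OF e(1) rc(1,2)]
  have d: "difference_loop S E a b = chain_class S E (e @ tl (rev c))"
    using difference_loop_eq[OF E c(1) e(1) ce] c e by simp
  show "difference_loop S E a b \<in> carrier (loop_group S p E)"
    unfolding d carrier_loop_group chain_space_iff
    using k e(2) rc(3) endpoint_class[OF k(1)] by auto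
  note m = concat_chain[OF rc(1) c(1) rc(4)]
  have "concat_class S E (difference_loop S E a b) a = chain_class S E ((e @ tl (rev c)) @ tl c)"
    using concat_class_eq[OF k(1) c(1)] k(3) rc(4) c(3) d by simp
  also have "(e @ tl (rev c)) @ tl c = e @ tl (rev c @ tl c)" using c0 by simp
  also have "homotopic S E (rev c @ tl c) [last e]"
    using homotopic_backtrack[OF E rc(1)] rc(2) by simp
  hence "homotopic S E (e @ tl (rev c @ tl c)) (e @ tl [last e])"
    using homotopic_concat[OF e(1) m(1) _ rtrancl_refl, of "[last e]"] m(2) rc(2) by simp
  hence "chain_class S E (e @ tl (rev c @ tl c)) = b"
    by (simp add: chain_class_eq_iff e(3))
  finally show "concat_class S E (difference_loop S E a b) a = b" .
qed

lemma difference_loop_chain_bond: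
  assumes "tolerance S D" "tolerance S E" "D \<subseteq> E"
    and ab: "a \<in> chain_space S p D" "b \<in> chain_space S p D" and same: "endpoint a = endpoint b"
  shows "chain_bond S E D (difference_loop S D a b) =
           difference_loop S E (chain_bond S E D a) (chain_bond S E D b)"
proof -
  obtain c where c: "is_chain S D c" "hd c = p" "a = chain_class S D c"
    using ab(1) by (rule chain_space_E)
  obtain e where e: "is_chain S D e" "hd e = p" "b = chain_class S D e"
    using ab(2) by (rule chain_space_E)
  have "last c = last e" using same c e by (simp add: endpoint_class)
  thus ?thesis
    using difference_loop_eq[OF assms(1) c(1) e(1)]
      difference_loop_eq[OF assms(2) is_chain_mono is_chain_mono, OF c(1) assms(3) e(1) assms(3)]
    by (simp add: c(3) e(3) chain_bond_class[OF assms(3)])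
qed

lemma group_loop_group:
  assumes E: "tolerance S E" and p: "p \<in> S"
  shows "group (loop_group S p E)"
proof (rule groupI)
  let ?G = "loop_group S p E"
  note sub = carrier_loop_group[of S p E]
  show one: "\<one>\<^bsub>?G\<^esub> \<in> carrier ?G"
    using base_class_in[OF p] endpoint_class[of S E "[p]"] p
    by (simp add: one_loop_group sub is_chain_singleton)
  fix g assume g: "g \<in> carrier ?G"
  show "\<one>\<^bsub>?G\<^esub> \<otimes>\<^bsub>?G\<^esub> g = g"
    using g concat_class_one[OF p] by (simp add: mult_loop_group one_loop_group sub)
  \<comment> \<open>The inverse is the loop that leads from \<open>g\<close> to the neutral class.\<close>
  show "\<exists>h\<in>carrier ?G. h \<otimes>\<^bsub>?G\<^esub> g = \<one>\<^bsub>?G\<^esub>"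
    using difference_loop[OF E, of g p "\<one>\<^bsub>?G\<^esub>"] g one by (auto simp: mult_loop_group sub)
  fix h assume h: "h \<in> carrier ?G"
  show "g \<otimes>\<^bsub>?G\<^esub> h \<in> carrier ?G"
    using concat_class_in[OF g, of h] h by (simp add: mult_loop_group sub)
  fix k assume "k \<in> carrier ?G"
  thus "g \<otimes>\<^bsub>?G\<^esub> h \<otimes>\<^bsub>?G\<^esub> k = g \<otimes>\<^bsub>?G\<^esub> (h \<otimes>\<^bsub>?G\<^esub> k)"
    using concat_class_assoc[OF g h, of k] by (simp add: mult_loop_group sub)
qed

lemma chain_bond_hom:
  assumes "D \<subseteq> E"
  shows "chain_bond S E D \<in> hom (loop_group S p D) (loop_group S p E)"
  using chain_bond_loop[OF assms] concat_class_chain_bond[OF assms]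
  by (auto simp: hom_def mult_loop_group carrier_loop_group)

lemma group_actionI:
  fixes G (structure)
  assumes "group G"
    and closed: "\<And>g x. g \<in> carrier G \<Longrightarrow> x \<in> X \<Longrightarrow> act g x \<in> X"
    and one: "\<And>x. x \<in> X \<Longrightarrow> act \<one> x = x"
    and mult: "\<And>g h x. g \<in> carrier G \<Longrightarrow> h \<in> carrier G \<Longrightarrow> x \<in> X \<Longrightarrow> act (g \<otimes> h) x = act g (act h x)"
  shows "group_action G X (\<lambda>g. \<lambda>x\<in>X. act g x)"
proof -
  interpret group G by fact
  have bij: "restrict (act g) X \<in> Bij X" if g: "g \<in> carrier G" for g
  proof -
    have i: "inv g \<in> carrier G" using g by simp
    have "bij_betw (act g) X X"
      by (rule bij_betw_byWitness[where f' = "act (inv g)"])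
        (use g i closed one mult[OF g i] mult[OF i g] in auto)
    thus ?thesis by (simp add: Bij_def bij_betw_restrict_eq)
  qed
  have "(\<lambda>g. restrict (act g) X) \<in> hom G (BijGroup X)"
  proof (rule homI)
    fix g h assume gh: "g \<in> carrier G" "h \<in> carrier G"
    show "restrict (act (g \<otimes> h)) X = restrict (act g) X \<otimes>\<^bsub>BijGroup X\<^esub> restrict (act h) X"
      using bij gh closed mult[OF gh]
      by (simp add: BijGroup_def compose_def fun_eq_iff restrict_def)
  qed (use bij in \<open>simp add: BijGroup_def\<close>)
  thus ?thesis
    unfolding group_action_def group_hom_def group_hom_axioms_def using group_BijGroup is_group by blast
qed

text \<open>
  Continuity of all translations suffices, since the inverse of a translation is the translation
  by the inverse.
\<close>

lemma uniform_actionI: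
  fixes G (structure)
  assumes U: "uniform_space_on X U" and act: "group_action G X \<phi>"
    and cont: "\<And>g. g \<in> carrier G \<Longrightarrow> filterlim (\<lambda>(x, y). (\<phi> g x, \<phi> g y)) U U"
  shows "uniform_action G X U \<phi>"
proof -
  interpret group_action G X \<phi> by fact
  interpret group G using group_hom group_hom.axioms(1) by blast
  have "uniform_homeomorphism X U X U (\<phi> g)" if g: "g \<in> carrier G" for g
  proof -
    have ig: "inv g \<in> carrier G" using g by simp
    have bij: "bij_betw (\<phi> h) X X" if "h \<in> carrier G" for h
      using bij_prop0[OF that] by (simp add: Bij_def)
    have inv: "inv_into X (\<phi> g) x = \<phi> (inv g) x" if x: "x \<in> X" for x
    proof (rule inv_into_f_eq)
      show "inj_on (\<phi> g) X" using bij[OF g] by (rule bij_betw_imp_inj_on)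
      show "\<phi> (inv g) x \<in> X" using bij[OF ig] x by (rule bij_betwE[rule_format])
      show "\<phi> g (\<phi> (inv g) x) = x"
        using composition_rule[OF x g ig] id_eq_one g x by (metis r_inv restrict_apply')
    qed
    have "\<forall>\<^sub>F q in U. q \<in> X \<times> X"
      using U unfolding uniform_space_on_def le_principal by blast
    hence "\<forall>\<^sub>F q in U. (case q of (x, y) \<Rightarrow> (inv_into X (\<phi> g) x, inv_into X (\<phi> g) y)) =
        (case q of (x, y) \<Rightarrow> (\<phi> (inv g) x, \<phi> (inv g) y))"
      by eventually_elim (auto simp: inv)
    hence "filterlim (\<lambda>(x, y). (inv_into X (\<phi> g) x, inv_into X (\<phi> g) y)) U U"
      using cont[OF ig] filterlim_cong[OF refl refl] by blast
    moreover have "inv_into X (\<phi> g) \<in> X \<rightarrow> X"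
      using bij_betw_inv_into[OF bij[OF g]] by (rule bij_betw_imp_funcset)
    ultimately show ?thesis
      using cont[OF g] bij[OF g]
      unfolding uniform_homeomorphism_def uniformly_continuous_between_def
      by (auto dest: bij_betw_imp_funcset)
  qed
  thus ?thesis using U act unfolding uniform_action_def by blast
qed

definition loop_action :: "'a set \<Rightarrow> 'a \<Rightarrow> 'a rel \<Rightarrow> 'a list set \<Rightarrow> 'a list set \<Rightarrow> 'a list set" where
  "loop_action S p E g = (\<lambda>a\<in>chain_space S p E. concat_class S E g a)"

text \<open>
  A translation keeps the endpoint, and two distinct classes with the same endpoint are never
  \<open>E\<^sup>*\<close>-close; so \<open>E\<^sup>*\<close> witnesses discreteness.
\<close>

lemma discrete_loop_action:
  assumes U: "uniform_space_on S U" and E: "E \<in> entourages S U" and p: "p \<in> S"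
  shows "discrete_action (loop_group S p E) (chain_space S p E) (chain_uniformity S p U E)
           (loop_action S p E)"
proof -
  let ?G = "loop_group S p E" and ?X = "chain_space S p E"
  note tol = entourages_tolerance[OF U]
  interpret group ?G using tol[OF E] p by (rule group_loop_group)
  have act: "group_action ?G ?X (loop_action S p E)"
    unfolding loop_action_def
    by (rule group_actionI[OF is_group])
      (simp_all add: mult_loop_group one_loop_group concat_class_one[OF p]
        concat_class_assoc[of _ S p E] concat_class_in[of _ S p E])
  have "filterlim (\<lambda>(a, b). (loop_action S p E g a, loop_action S p E g b))
      (chain_uniformity S p U E) (chain_uniformity S p U E)" if g: "g \<in> carrier ?G" for g
    unfolding chain_uniformity_def
  proof (rule filterlim_base)
    fix D q assume D: "D \<in> {D \<in> entourages S U. D \<subseteq> E}" and q: "q \<in> lift_entourage S p E D"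
    obtain a b where ab: "q = (a, b)" by force
    have "tolerance S D" "D \<subseteq> E" using D tol by auto
    thus "(case q of (a, b) \<Rightarrow> (loop_action S p E g a, loop_action S p E g b)) \<in> lift_entourage S p E D"
      using concat_class_lift[OF tol[OF E] _ _ g] q lift_in_space[of a b S p E D]
      by (simp add: ab loop_action_def)
  qed
  with act have ua: "uniform_action ?G ?X (chain_uniformity S p U E) (loop_action S p E)"
    using uniform_space_on_chain_space[OF U E] by (intro uniform_actionI)
  have "lift_entourage S p E E \<in> entourages ?X (chain_uniformity S p U E)"
    using lift_sym[OF tol[OF E]] lift_in_space[of _ _ S p E E] E
    by (auto simp: entourages_def eventually_chain_uniformity[OF E] intro!: symI)
  moreover have "g = \<one>\<^bsub>?G\<^esub>" if g: "g \<in> carrier ?G" and a: "a \<in> ?X"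
    and ga: "(loop_action S p E g a, a) \<in> lift_entourage S p E E" for g a
  proof -
    have "concat_class S E g a = a"
      using lift_same_endpoint[OF ga] concat_class_in[OF g a] a
      by (simp add: loop_action_def)
    then obtain l c where l: "is_chain S E l" "hd l = p" "last l = p" "g = chain_class S E l"
      and c: "is_chain S E c" "hd c = p" "a = chain_class S E c"
      and eq: "concat_class S E (chain_class S E l) (chain_class S E c) = chain_class S E c"
      using loop_E[OF g] chain_space_E[OF a] by metis
    have lc: "last l = hd c" using l c by simp
    have h: "homotopic S E (l @ tl c) c"
      using eq concat_class_eq[OF l(1) c(1) lc] by (metis chain_class_eq_iff)
    have c0: "c \<noteq> []" using c(1) by (rule is_chain_not_Nil)
    have rc: "is_chain S E (rev c)" "last c = hd (rev c)"
      using c(1) c0 tol[OF E] by (simp_all add: is_chain_rev hd_rev)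
    note k = concat_chain[OF l(1) c(1) lc]
    have bt: "homotopic S E (c @ tl (rev c)) [p]"
      using homotopic_backtrack[OF tol[OF E] c(1)] c(2) by simp
    \<comment> \<open>Cancel \<open>c\<close> on the right: \<open>l\<close> is homotopic to \<open>l c c\<inverse>\<close>, hence to \<open>c c\<inverse>\<close>, hence to \<open>p\<close>.\<close>
    have "homotopic S E (l @ tl [p]) (l @ tl (c @ tl (rev c)))"
      using homotopic_sym[OF homotopic_concat[OF l(1) concat_chain(1)[OF c(1) rc] _ rtrancl_refl bt]]
        l c c0 by simp
    also have "l @ tl (c @ tl (rev c)) = (l @ tl c) @ tl (rev c)" using c0 by simp
    also have "homotopic S E ((l @ tl c) @ tl (rev c)) (c @ tl (rev c))"
      using homotopic_concat[OF k(1) rc(1) _ h rtrancl_refl] k(3) rc(2) by simp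
    also note bt
    finally (homotopic_trans) show ?thesis
      using l(4) by (simp add: one_loop_group chain_class_eq_iff)
  qed
  ultimately show ?thesis using ua unfolding discrete_action_def by blast
qed

section \<open>Chains upstairs\<close>

text \<open>
  The values of \<open>t\<close> at \<open>us @ ws\<close>, where \<open>ws\<close> runs through the non-empty initial segments of \<open>vs\<close>.
\<close>

fun prefix_values :: "('a list \<Rightarrow> 'y) \<Rightarrow> 'a list \<Rightarrow> 'a list \<Rightarrow> 'y list" where
  "prefix_values t us [] = []"
| "prefix_values t us (v # vs) = t (us @ [v]) # prefix_values t (us @ [v]) vs"

lemma prefix_values_append:
  "prefix_values t us (vs @ ws) = prefix_values t us vs @ prefix_values t (us @ vs) ws"
  by (induction vs arbitrary: us) auto

lemma prefix_values_cong:
  assumes "\<And>ws zs. ws \<noteq> [] \<Longrightarrow> vs = ws @ zs \<Longrightarrow> t (us @ ws) = t (us' @ ws)"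
  shows "prefix_values t us vs = prefix_values t us' vs"
  using assms
proof (induction vs arbitrary: us us')
  case (Cons v vs)
  have "t (us @ [v]) = t (us' @ [v])" using Cons.prems[of "[v]"] by simp
  moreover have "prefix_values t (us @ [v]) vs = prefix_values t (us' @ [v]) vs"
    using Cons.prems[of "v # ws" for ws] by (intro Cons.IH) simp
  ultimately show ?case by simp
qed simp

text \<open>
  A set \<open>Y\<close> that maps onto \<open>X\<^sub>E\<close>, to be equipped with the preimage \<open>W\<close> of the entourage \<open>E\<^sup>*\<close>. The
  aim is that \<open>Y\<close> is simply connected at the scale \<open>W\<close>: the endpoint map \<open>Y\<^sub>W \<rightarrow> Y\<close> is bijective.
\<close>

locale chain_pullback =
  fixes S :: "'a set" and E :: "'a rel" and p :: 'a and \<pi> :: "'y \<Rightarrow> 'a list set" and Y :: "'y set" and q :: 'y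
  assumes tol: "tolerance S E" and p: "p \<in> S" and onto: "\<pi> ` Y = chain_space S p E"
    and q: "q \<in> Y" "\<pi> q = chain_class S E [p]"
begin

definition W :: "'y rel" where
  "W = {(x, y). x \<in> Y \<and> y \<in> Y \<and> (\<pi> x, \<pi> y) \<in> lift_entourage S p E E}"

text \<open>
  A section of \<open>\<pi>\<close>. Its value at the basepoint is prescribed, so that lifted chains start at \<open>q\<close>.
\<close>

definition sect :: "'a list set \<Rightarrow> 'y" where
  "sect a = (if a = chain_class S E [p] then q else inv_into Y \<pi> a)"

lemma sect:
  assumes "a \<in> chain_space S p E"
  shows "sect a \<in> Y" "\<pi> (sect a) = a"
  using assms onto q unfolding sect_def by (auto simp: inv_into_into f_inv_into_f)

lemma tolerance_W: "tolerance Y W"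
  using lift_refl[OF tol tol order_refl, of "\<pi> x" for x] lift_sym[OF tol] imageI[of _ Y \<pi>]
  unfolding tolerance_def W_def onto by (auto intro!: symI refl_onI)

text \<open>
  The lift of a chain of \<open>X\<close>: its vertices are the classes of the initial segments, moved into \<open>Y\<close>
  by the section.
\<close>

definition chain_lift :: "'a list \<Rightarrow> 'y list" where
  "chain_lift c = prefix_values (\<lambda>c. sect (chain_class S E c)) [] c"

lemma chain_lift_snoc: "chain_lift (c @ [x]) = chain_lift c @ [sect (chain_class S E (c @ [x]))]"
  by (simp add: chain_lift_def prefix_values_append)

lemma lift_snoc:
  assumes "is_chain S E c" "hd c = p" "is_chain S E (c @ [x])"
  shows "(chain_class S E c, chain_class S E (c @ [x])) \<in> lift_entourage S p E E"
  using lift_class_iff[OF tol tol order_refl assms(1,2)] assms is_chain_snoc[OF tol]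
    is_chain_not_Nil[OF assms(1)] by auto

lemma chain_lift_chain:
  assumes "is_chain S E c" "hd c = p"
  shows "is_chain Y W (chain_lift c) \<and> hd (chain_lift c) = q \<and> last (chain_lift c) = sect (chain_class S E c)"
  using assms
proof (induction c rule: rev_induct)
  case (snoc x c)
  show ?case
  proof (cases "c = []")
    case True
    hence "x = p" using snoc.prems by simp
    thus ?thesis using True q p by (simp add: chain_lift_def sect_def is_chain_singleton)
  next
    case False
    have c: "is_chain S E c" "hd c = p" using snoc.prems False is_chain_snoc[OF tol False] by auto
    note IH = snoc.IH[OF c]
    have in_space: "chain_class S E c \<in> chain_space S p E" "chain_class S E (c @ [x]) \<in> chain_space S p E"
      using c snoc.prems unfolding chain_space_iff by blast+
    have "(last (chain_lift c), sect (chain_class S E (c @ [x]))) \<in> W"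
      using lift_snoc[OF c snoc.prems(1)] sect[OF in_space(1)] sect[OF in_space(2)] IH
      by (simp add: W_def)
    thus ?thesis
      using IH is_chain_snoc[OF tolerance_W] is_chain_not_Nil[of Y W "chain_lift c"] by (simp add: chain_lift_snoc)
  qed
qed (simp add: is_chain_def)

text \<open>
  An initial segment that ends behind the inserted vertex is homotopic to the corresponding segment
  without that vertex. So the lift changes by one inserted vertex only.
\<close>

lemma chain_lift_insertion_step:
  assumes xx': "(x, x') \<in> insertion_step S E" and hd: "hd x = p"
  shows "(chain_lift x, chain_lift x') \<in> insertion_step Y W"
proof -
  obtain us z vs where x: "x = us @ vs" "x' = us @ z # vs"
    using xx' by (auto simp: insertion_step_def)
  have chains: "is_chain S E x" "is_chain S E x'" "hd x = hd x'" "last x = last x'"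
    using xx' by (auto simp: insertion_step_def)
  let ?t = "\<lambda>c. sect (chain_class S E c)"
  have "prefix_values ?t (us @ [z]) vs = prefix_values ?t us vs"
  proof (rule prefix_values_cong)
    fix ws zs assume ws: "ws \<noteq> []" "vs = ws @ zs"
    have "is_chain S E (us @ ws)" "is_chain S E (us @ z # ws)"
      using chains(1,2) ws unfolding x is_chain_def
      by (auto simp: successively_append_iff successively_Cons)
    moreover have "hd (us @ ws) = hd (us @ z # ws)"
      using chains(3) ws unfolding x by (cases us) auto
    ultimately have "(us @ ws, us @ z # ws) \<in> insertion_step S E"
      using ws unfolding insertion_step_def by auto
    hence "homotopic S E (us @ ws) (us @ z # ws)" by blast
    hence "chain_class S E (us @ ws) = chain_class S E (us @ z # ws)"
      by (simp add: chain_class_eq_iff)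
    thus "?t ((us @ [z]) @ ws) = ?t (us @ ws)" by simp
  qed
  hence "chain_lift x = prefix_values ?t [] us @ prefix_values ?t us vs"
    "chain_lift x' = prefix_values ?t [] us @ ?t (us @ [z]) # prefix_values ?t us vs"
    unfolding chain_lift_def x by (simp_all add: prefix_values_append)
  moreover have "chain_class S E x = chain_class S E x'"
    using xx' by (auto simp: chain_class_eq_iff)
  ultimately show ?thesis
    using chain_lift_chain[OF chains(1) hd] chain_lift_chain[OF chains(2)] hd chains(3)
    unfolding insertion_step_def by auto
qed

lemma chain_lift_homotopic:
  assumes "homotopic S E c c'" "is_chain S E c" "hd c = p"
  shows "homotopic Y W (chain_lift c) (chain_lift c')"
  using assms(1)
proof (induction rule: rtrancl_induct)
  case (step a b)
  have a: "hd a = p" and b: "hd b = p"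
    using homotopic_invariants[OF step(1) assms(2)]
      homotopic_invariants[OF rtrancl_into_rtrancl[OF step(1,2)] assms(2)] assms(3) by auto
  have "(chain_lift a, chain_lift b) \<in> insertion_step Y W \<union> (insertion_step Y W)\<inverse>"
    using step(2) chain_lift_insertion_step[OF _ a] chain_lift_insertion_step[OF _ b] by blast
  thus ?case using step(3) by (rule rtrancl_into_rtrancl[rotated])
qed simp

lemma W_replace: "x \<in> Y \<Longrightarrow> y \<in> Y \<Longrightarrow> (sect (\<pi> x), y) \<in> W \<longleftrightarrow> (x, y) \<in> W"
  using sect[of "\<pi> x"] imageI[of x Y \<pi>] unfolding W_def onto by auto

text \<open>
  A chain upstairs is determined up to homotopy by its last vertex and its shadow in \<open>X\<close>: since
  membership in \<open>W\<close> is decided in \<open>X\<^sub>E\<close>, every vertex but the last may be exchanged for the chosen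
  point in its fibre.
\<close>

lemma W_chain_normal_form:
  assumes "is_chain Y W c" "hd c = q"
  shows "\<exists>x. is_chain S E x \<and> hd x = p \<and> \<pi> (last c) = chain_class S E x \<and>
             is_chain Y W (chain_lift x @ [last c]) \<and> homotopic Y W c (chain_lift x @ [last c])"
  using assms
proof (induction c rule: rev_induct)
  case (snoc y c)
  show ?case
  proof (cases "c = []")
    case True
    hence "y = q" using snoc.prems by simp
    have *: "is_chain Y W [q]" using q by (simp add: is_chain_singleton)
    have "homotopic Y W [q] [q, q]" using homotopic_double[OF tolerance_W *] .
    moreover have "chain_lift [p] = [q]" by (simp add: chain_lift_def sect_def)
    moreover have "is_chain Y W [q, q]"
      using homotopic_invariants[OF \<open>homotopic Y W [q] [q, q]\<close> *] by blast
    ultimately show ?thesis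
      using True \<open>y = q\<close> p q by (intro exI[of _ "[p]"]) (simp add: is_chain_singleton)
  next
    case False
    have c: "is_chain Y W c" "hd c = q" "(last c, y) \<in> W"
      using snoc.prems False is_chain_snoc[OF tolerance_W False] by auto
    obtain x where x: "is_chain S E x" "hd x = p" "\<pi> (last c) = chain_class S E x"
      and Lx: "is_chain Y W (chain_lift x @ [last c])" "homotopic Y W c (chain_lift x @ [last c])"
      using snoc.IH[OF c(1,2)] by blast
    have x0: "x \<noteq> []" and Lx0: "chain_lift x \<noteq> []"
      using x(1) chain_lift_chain[OF x(1,2)] by (auto dest: is_chain_not_Nil)
    have yY: "last c \<in> Y" "y \<in> Y" using c(3) by (auto simp: W_def)
    have "(chain_class S E x, \<pi> y) \<in> lift_entourage S p E E" using c(3) x(3) by (simp add: W_def)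
    then obtain z where z: "(last x, z) \<in> E" "\<pi> y = chain_class S E (x @ [z])"
      unfolding lift_class_iff[OF tol tol order_refl x(1,2)] by blast
    have xz: "is_chain S E (x @ [z])" "hd (x @ [z]) = p"
      using is_chain_snoc[OF tol x0] x z x0 by auto
    have Lxz: "chain_lift (x @ [z]) = chain_lift x @ [sect (\<pi> y)]" using chain_lift_snoc z(2) by simp
    have space: "\<pi> y \<in> chain_space S p E" using onto yY by blast
    have yy: "(sect (\<pi> y), y) \<in> W"
      using W_replace[OF yY(2,2)] toleranceD(4)[OF tolerance_W] yY by blast
    have cs: "(last c, sect (\<pi> y)) \<in> W"
      using c(3) sect[OF space] unfolding W_def by simp
    have ch: "is_chain Y W (chain_lift (x @ [z]))" using chain_lift_chain[OF xz] by blast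
    have ch1: "is_chain Y W (chain_lift x @ [sect (\<pi> y), y])"
      using is_chain_snoc[OF tolerance_W, of "chain_lift x @ [sect (\<pi> y)]" y] ch Lxz yy by simp
    have ch2: "is_chain Y W (chain_lift x @ [last c, y])"
      using is_chain_snoc[OF tolerance_W, of "chain_lift x @ [last c]" y] Lx(1) c(3) by simp
    have ch3: "is_chain Y W (chain_lift x @ [last c, sect (\<pi> y), y])"
      using is_chain_snoc[OF tolerance_W, of "chain_lift x @ [last c]" "sect (\<pi> y)"]
        is_chain_snoc[OF tolerance_W, of "chain_lift x @ [last c, sect (\<pi> y)]" y] Lx(1) cs yy by simp
    have "homotopic Y W (c @ [y]) (chain_lift x @ [last c, y])"
      using homotopic_context[OF Lx(2) c(1), of "[]" "[y]"] snoc.prems(1) by simp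
    also have "homotopic Y W (chain_lift x @ [last c, y]) (chain_lift x @ [last c, sect (\<pi> y), y])"
      using homotopic_insert[of Y W "chain_lift x @ [last c]" "[y]"] ch2 ch3 by simp
    also have "homotopic Y W (chain_lift x @ [last c, sect (\<pi> y), y]) (chain_lift x @ [sect (\<pi> y), y])"
      using homotopic_sym[OF homotopic_insert[of Y W "chain_lift x" "[sect (\<pi> y), y]" "last c"]] ch1 ch3 Lx0
      by simp
    finally (homotopic_trans) show ?thesis
      using xz z(2) ch1 Lxz by (intro exI[of _ "x @ [z]"]) simp
  qed
qed (simp add: is_chain_def)

text \<open>
  For injectivity, two chains upstairs with the same last vertex \<open>y\<close> have shadows in the single
  class \<open>\<pi> y\<close>; a homotopy between the shadows lifts to one between the normal forms. For
  surjectivity, \<open>y\<close> is appended to the lift of a chain in the class \<open>\<pi> y\<close>.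
\<close>

lemma bij_betw_endpoint: "bij_betw endpoint (chain_space Y q W) Y"
proof (intro bij_betw_imageI)
  show "inj_on endpoint (chain_space Y q W)"
  proof (rule inj_onI)
    fix A B assume A: "A \<in> chain_space Y q W" and B: "B \<in> chain_space Y q W"
      and eq: "endpoint A = endpoint B"
    obtain a where a: "is_chain Y W a" "hd a = q" "A = chain_class Y W a" using A by (rule chain_space_E)
    obtain b where b: "is_chain Y W b" "hd b = q" "B = chain_class Y W b" using B by (rule chain_space_E)
    have ab: "last a = last b" using eq a b by (simp add: endpoint_class)
    obtain x where x: "is_chain S E x" "hd x = p" "\<pi> (last a) = chain_class S E x"
      and Lx: "is_chain Y W (chain_lift x @ [last a])" "homotopic Y W a (chain_lift x @ [last a])"
      using W_chain_normal_form[OF a(1,2)] by blast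
    obtain y where y: "is_chain S E y" "hd y = p" "\<pi> (last b) = chain_class S E y"
      and Ly: "homotopic Y W b (chain_lift y @ [last b])"
      using W_chain_normal_form[OF b(1,2)] by blast
    have "homotopic S E x y" using x(3) y(3) ab by (simp add: chain_class_eq_iff[symmetric])
    hence h: "homotopic Y W (chain_lift x) (chain_lift y)" by (rule chain_lift_homotopic[OF _ x(1,2)])
    have "homotopic Y W (chain_lift x @ [last a]) (chain_lift y @ [last b])"
      using homotopic_context[OF h, of "[]" "[last a]"] Lx(1) chain_lift_chain[OF x(1,2)] ab by simp
    hence "homotopic Y W a b" using homotopic_trans[OF Lx(2)] homotopic_trans[OF _ homotopic_sym[OF Ly]] by blast
    thus "A = B" using a b by (simp add: chain_class_eq_iff)
  qed
next
  have "y \<in> endpoint ` chain_space Y q W" if y: "y \<in> Y" for y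
  proof -
    have space: "\<pi> y \<in> chain_space S p E" using onto y by blast
    then obtain x where x: "is_chain S E x" "hd x = p" "\<pi> y = chain_class S E x" by (rule chain_space_E)
    have Lx: "is_chain Y W (chain_lift x)" "hd (chain_lift x) = q" "last (chain_lift x) = sect (\<pi> y)"
      using chain_lift_chain[OF x(1,2)] x(3) by auto
    have "(sect (\<pi> y), y) \<in> W" using W_replace[OF y y] toleranceD(4)[OF tolerance_W y] by blast
    hence Lxy: "is_chain Y W (chain_lift x @ [y])" "hd (chain_lift x @ [y]) = q"
      using Lx is_chain_snoc[OF tolerance_W] is_chain_not_Nil[OF Lx(1)] by simp_all
    hence "chain_class Y W (chain_lift x @ [y]) \<in> chain_space Y q W"
      unfolding chain_space_iff by (intro exI[of _ "chain_lift x @ [y]"]) simp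
    moreover have "endpoint (chain_class Y W (chain_lift x @ [y])) = y"
      using endpoint_class[OF Lxy(1)] by simp
    ultimately show ?thesis by (metis imageI)
  qed
  moreover have "endpoint ` chain_space Y q W \<subseteq> Y" using endpoint_in by (rule image_subsetI)
  ultimately show "endpoint ` chain_space Y q W = Y" by (simp add: set_eq_subset subsetI)
qed

end

section \<open>Inverse limits and cofinal subsystems\<close>

lemma inverse_limit_in: "x \<in> inverse_limit I r T f \<Longrightarrow> i \<in> I \<Longrightarrow> x i \<in> T i"
  by (auto simp: inverse_limit_def)

lemma inverse_limit_bond: "x \<in> inverse_limit I r T f \<Longrightarrow> (i, j) \<in> r \<Longrightarrow> f i j (x j) = x i"
  by (auto simp: inverse_limit_def)

lemma inverse_limitI:
  assumes "\<And>i. i \<in> I \<Longrightarrow> x i \<in> T i" "\<And>i. i \<notin> I \<Longrightarrow> x i = undefined"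
    "\<And>i j. (i, j) \<in> r \<Longrightarrow> f i j (x j) = x i"
  shows "x \<in> inverse_limit I r T f"
  using assms by (auto simp: inverse_limit_def)

lemma inverse_limit_eqI:
  assumes "x \<in> inverse_limit I r T f" "y \<in> inverse_limit I r T f" "\<And>i. i \<in> I \<Longrightarrow> x i = y i"
  shows "x = y"
  using assms by (auto simp: inverse_limit_def intro: PiE_ext)

lemma group_inverse_limit_group:
  assumes H: "\<And>i. i \<in> I \<Longrightarrow> group (H i)" and r: "r \<subseteq> I \<times> I"
    and h: "\<And>i j. (i, j) \<in> r \<Longrightarrow> h i j \<in> hom (H j) (H i)"
  shows "group (inverse_limit_group I r H h)"
proof (rule groupI)
  let ?G = "inverse_limit_group I r H h" and ?C = "inverse_limit I r (\<lambda>i. carrier (H i)) h"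
  have carr: "carrier ?G = ?C" and one: "\<one>\<^bsub>?G\<^esub> = (\<lambda>i\<in>I. \<one>\<^bsub>H i\<^esub>)"
    and mult: "x \<otimes>\<^bsub>?G\<^esub> y = (\<lambda>i\<in>I. x i \<otimes>\<^bsub>H i\<^esub> y i)" for x y
    by (simp_all add: inverse_limit_group_def)
  have rI: "i \<in> I" "j \<in> I" if "(i, j) \<in> r" for i j using r that by auto
  have hh: "group_hom (H j) (H i) (h i j)" if "(i, j) \<in> r" for i j
    using H h rI[OF that] that by (simp add: group_hom_def group_hom_axioms_def)
  show one_in: "\<one>\<^bsub>?G\<^esub> \<in> carrier ?G"
    unfolding carr one
    using H rI group_hom.hom_one[OF hh] by (intro inverse_limitI) (auto simp: group.is_monoid)
  fix x assume x: "x \<in> carrier ?G"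
  note xi = inverse_limit_in[OF x[unfolded carr]]
  show "\<one>\<^bsub>?G\<^esub> \<otimes>\<^bsub>?G\<^esub> x = x"
  proof
    fix i show "(\<one>\<^bsub>?G\<^esub> \<otimes>\<^bsub>?G\<^esub> x) i = x i"
      using x H xi unfolding carr one mult
      by (cases "i \<in> I") (auto simp: inverse_limit_def group.is_monoid monoid.l_one)
  qed
  have "(\<lambda>i\<in>I. inv\<^bsub>H i\<^esub> x i) \<in> carrier ?G"
    unfolding carr using H xi rI group_hom.hom_inv[OF hh] inverse_limit_bond[OF x[unfolded carr]]
    by (intro inverse_limitI) (auto simp: group.inv_closed)
  moreover have "(\<lambda>i\<in>I. inv\<^bsub>H i\<^esub> x i) \<otimes>\<^bsub>?G\<^esub> x = \<one>\<^bsub>?G\<^esub>"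
    unfolding mult one using H xi by (auto simp: fun_eq_iff group.l_inv)
  ultimately show "\<exists>y\<in>carrier ?G. y \<otimes>\<^bsub>?G\<^esub> x = \<one>\<^bsub>?G\<^esub>" by blast
  fix y assume y: "y \<in> carrier ?G"
  note yi = inverse_limit_in[OF y[unfolded carr]]
  show "x \<otimes>\<^bsub>?G\<^esub> y \<in> carrier ?G"
    unfolding carr mult
    using H xi yi rI hom_mult[OF h] inverse_limit_bond[OF x[unfolded carr]]
      inverse_limit_bond[OF y[unfolded carr]]
    by (intro inverse_limitI) (auto simp: group.is_monoid monoid.m_closed)
  fix z assume z: "z \<in> carrier ?G"
  note zi = inverse_limit_in[OF z[unfolded carr]]
  show "x \<otimes>\<^bsub>?G\<^esub> y \<otimes>\<^bsub>?G\<^esub> z = x \<otimes>\<^bsub>?G\<^esub> (y \<otimes>\<^bsub>?G\<^esub> z)"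
    unfolding mult using H xi yi zi by (auto simp: fun_eq_iff group.is_monoid monoid.m_assoc)
qed

text \<open>
  A family over a cofinal set extends to all indices by applying bonding maps. The value at \<open>i\<close> does
  not depend on the index \<open>j\<close> it is computed from, as two such indices have a common successor in
  the cofinal set.
\<close>

lemma inverse_limit_restrict_bij:
  assumes sys: "inverse_system I r T f" and dir: "directed_set I r"
    and J: "J \<subseteq> I" and cofinal: "\<And>i. i \<in> I \<Longrightarrow> \<exists>j\<in>J. (i, j) \<in> r"
  shows "bij_betw (\<lambda>x. restrict x J) (inverse_limit I r T f) (inverse_limit J (r \<inter> J \<times> J) T f)"
proof -
  have tr: "trans r" and rI: "r \<subseteq> I \<times> I"
    using dir by (auto simp: directed_set_def preorder_on_def)
  have f_in: "f i j x \<in> T i" if "(i, j) \<in> r" "x \<in> T j" for i j x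
    using sys that unfolding inverse_system_def by blast
  have f_comp: "f i j (f j k x) = f i k x" if "(i, j) \<in> r" "(j, k) \<in> r" "x \<in> T k" for i j k x
    using sys that unfolding inverse_system_def by blast
  have f_id: "f i i x = x" if "i \<in> I" "x \<in> T i" for i x
    using sys that unfolding inverse_system_def by blast
  show ?thesis
  proof (intro bij_betw_imageI inj_onI equalityI subsetI)
    fix x y assume x: "x \<in> inverse_limit I r T f" and y: "y \<in> inverse_limit I r T f"
      and eq: "restrict x J = restrict y J"
    show "x = y"
    proof (rule inverse_limit_eqI[OF x y])
      fix i assume "i \<in> I"
      then obtain j where j: "j \<in> J" "(i, j) \<in> r" using cofinal by blast
      hence "x j = y j" using eq by (metis restrict_apply')
      thus "x i = y i"
        using inverse_limit_bond[OF x j(2)] inverse_limit_bond[OF y j(2)] by simp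
    qed
  next
    fix y assume "y \<in> (\<lambda>x. restrict x J) ` inverse_limit I r T f"
    then obtain x where x: "x \<in> inverse_limit I r T f" "y = restrict x J" by blast
    show "y \<in> inverse_limit J (r \<inter> J \<times> J) T f"
      unfolding x(2) using inverse_limit_in[OF x(1)] inverse_limit_bond[OF x(1)] J
      by (intro inverse_limitI) auto
  next
    fix y assume y: "y \<in> inverse_limit J (r \<inter> J \<times> J) T f"
    \<comment> \<open>Compare both sides with the coordinate at a common successor \<open>k\<close>.\<close>
    have indep: "f i j (y j) = f i j' (y j')"
      if j: "(i, j) \<in> r" "j \<in> J" and j': "(i, j') \<in> r" "j' \<in> J" for i j j'
    proof -
      obtain m where "m \<in> I" "(j, m) \<in> r" "(j', m) \<in> r"
        using dir j(2) j'(2) J unfolding directed_set_def by blast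
      then obtain k where k: "k \<in> J" "(j, k) \<in> r" "(j', k) \<in> r"
        using cofinal[of m] transD[OF tr] by blast
      have "y k \<in> T k" using inverse_limit_in[OF y k(1)] .
      hence "f i l (y l) = f i k (y k)" if "(i, l) \<in> r" "(l, k) \<in> r" "l \<in> J" for l
        using inverse_limit_bond[OF y, of l k] f_comp[of i l k "y k"] that k(1) by simp
      thus ?thesis using j j' k by metis
    qed
    define c where "c i = (SOME j. j \<in> J \<and> (i, j) \<in> r)" for i
    have c: "c i \<in> J" "(i, c i) \<in> r" if "i \<in> I" for i
      using someI_ex[of "\<lambda>j. j \<in> J \<and> (i, j) \<in> r"] cofinal[OF that] unfolding c_def by blast+
    define x where "x = (\<lambda>i\<in>I. f i (c i) (y (c i)))"
    have "x \<in> inverse_limit I r T f"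
    proof (rule inverse_limitI)
      fix i assume i: "i \<in> I"
      show "x i \<in> T i" using f_in c[OF i] inverse_limit_in[OF y] i by (simp add: x_def)
    next
      fix i j assume ij: "(i, j) \<in> r"
      hence I: "i \<in> I" "j \<in> I" using rI by auto
      have "f i j (x j) = f i (c j) (y (c j))"
        using f_comp[OF ij c(2)] inverse_limit_in[OF y] c(1) I by (simp add: x_def)
      also have "\<dots> = x i"
        using indep[of i "c j" "c i"] c[OF I(1)] c[OF I(2)] transD[OF tr ij] I by (simp add: x_def)
      finally show "f i j (x j) = x i" .
    qed (simp add: x_def)
    moreover have "restrict x J = y"
    proof
      fix i show "restrict x J i = y i"
      proof (cases "i \<in> J")
        case True
        hence i: "i \<in> I" using J by blast
        hence ii: "(i, i) \<in> r"
          using dir by (auto simp: directed_set_def preorder_on_def refl_on_def)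
        have "x i = f i i (y i)"
          using indep[OF c(2,1)[OF i] ii True] i by (simp add: x_def)
        thus ?thesis using True f_id[OF i inverse_limit_in[OF y True]] by simp
      next
        case False
        thus ?thesis using y by (auto simp: inverse_limit_def)
      qed
    qed
    ultimately show "y \<in> (\<lambda>x. restrict x J) ` inverse_limit I r T f" by blast
  qed
qed

section \<open>The limit of the spaces of homotopy classes\<close>

text \<open>At a scale at which all vertices are close, a chain contracts to the edge between its endpoints.\<close>

lemma homotopic_clique:
  assumes "tolerance S E" "c \<noteq> []" "\<And>u v. u \<in> set c \<Longrightarrow> v \<in> set c \<Longrightarrow> (u, v) \<in> E"
  shows "is_chain S E c \<and> homotopic S E c [hd c, last c]"
  using assms(2,3)
proof (induction c)
  case (Cons x c)
  have x: "x \<in> S" using Cons.prems(2)[of x x] toleranceD(1)[OF assms(1)] by simp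
  show ?case
  proof (cases "c = []")
    case True
    thus ?thesis using x homotopic_double[OF assms(1), of x] by (simp add: is_chain_singleton)
  next
    case False
    have IH: "is_chain S E c" "homotopic S E c [hd c, last c]" using Cons False by auto
    have E: "(x, hd c) \<in> E" "(x, last c) \<in> E" "(hd c, last c) \<in> E"
      using Cons.prems(2) False by simp_all
    have S: "hd c \<in> S" "last c \<in> S" using toleranceD[OF assms(1)] E by blast+
    have ch: "is_chain S E (x # c)" "is_chain S E ([x] @ [last c])"
      "is_chain S E ([x] @ hd c # [last c])"
      using IH(1) E S x False by (simp_all add: is_chain_Cons is_chain_singleton)
    have "homotopic S E (x # c) ([x] @ hd c # [last c])"
      using homotopic_context[OF IH(2,1), of "[x]" "[]"] ch(1) by simp
    also have "homotopic S E ([x] @ hd c # [last c]) ([x] @ [last c])"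
      using homotopic_sym[OF homotopic_insert[OF ch(2,3)]] by simp
    finally (homotopic_trans) show ?thesis using ch(1) False by simp
  qed
qed simp

lemma inverse_system_chain_spaces:
  "inverse_system I (reverse_inclusion I) (chain_space S p) (chain_bond S)"
  unfolding inverse_system_def reverse_inclusion_def
  using chain_bond_in[of _ _ _ S p] chain_bond_id[of _ S p] chain_bond_comp[of _ _ _ _ S p] by auto

lemma inverse_system_loop_groups:
  "inverse_system I (reverse_inclusion I) (\<lambda>E. carrier (loop_group S p E)) (chain_bond S)"
proof -
  have *: "a \<in> chain_space S p E" if "a \<in> carrier (loop_group S p E)" for a E
    using that by (simp add: carrier_loop_group)
  show ?thesis
    unfolding inverse_system_def reverse_inclusion_def
    using chain_bond_loop[of _ _ _ S p] chain_bond_id[OF *] chain_bond_comp[OF _ _ *] by auto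
qed

lemma directed_set_reverse_inclusion:
  assumes "I \<noteq> {}" "\<And>D E. D \<in> I \<Longrightarrow> E \<in> I \<Longrightarrow> \<exists>F\<in>I. F \<subseteq> D \<inter> E"
  shows "directed_set I (reverse_inclusion I)"
  using assms unfolding directed_set_def preorder_on_def reverse_inclusion_def
  by (auto simp: refl_on_def trans_def)

text \<open>
  A coverable metric space, with a base \<open>B\<close> that witnesses coverability.
\<close>

locale coverable_metric = Metric_space M d for M :: "'a set" and d :: "'a \<Rightarrow> 'a \<Rightarrow> real" +
  fixes p :: 'a and B :: "'a rel set"
  assumes p: "p \<in> M"
    and base: "entourage_base M (metric_uniformity M d) B"
    and Times: "M \<times> M \<in> B"
    and onto: "\<And>E. E \<in> B \<Longrightarrow>
      (\<lambda>x. x E) ` chain_limit M p (metric_uniformity M d) = chain_space M p E"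
begin

abbreviation "U \<equiv> metric_uniformity M d"
abbreviation "Ent \<equiv> entourages M U"
abbreviation "N \<equiv> metric_entourage M d"
abbreviation "Y \<equiv> chain_limit M p U"
abbreviation "G \<equiv> deck_group M p U"

lemma U: "uniform_space_on M U"
  using uniform_space_on_metric Metric_space_axioms .

lemma tol: "E \<in> Ent \<Longrightarrow> tolerance M E"
  using entourages_tolerance[OF U] .

lemma N_Ent: "0 < r \<Longrightarrow> N r \<in> Ent"
  using metric_entourage_in_entourages[OF Metric_space_axioms] .

lemma N_mono: "r \<le> s \<Longrightarrow> N r \<subseteq> N s"
  by (auto simp: metric_entourage_def)

lemma B_Ent: "E \<in> B \<Longrightarrow> E \<in> Ent"
  using base by (auto simp: entourage_base_def)

lemma B_below: "E \<in> Ent \<Longrightarrow> \<exists>D\<in>B. D \<subseteq> E"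
  using base by (auto simp: entourage_base_def)

lemma Y_in: "x \<in> Y \<Longrightarrow> E \<in> Ent \<Longrightarrow> x E \<in> chain_space M p E"
  unfolding chain_limit_def by (rule inverse_limit_in)

lemma Y_bond: "x \<in> Y \<Longrightarrow> D \<in> Ent \<Longrightarrow> E \<in> Ent \<Longrightarrow> D \<subseteq> E \<Longrightarrow> chain_bond M E D (x D) = x E"
  unfolding chain_limit_def
  by (rule inverse_limit_bond[where f = "chain_bond M" and i = E and j = D]) (auto simp: reverse_inclusion_def)

lemma G_in: "g \<in> carrier G \<Longrightarrow> E \<in> Ent \<Longrightarrow> g E \<in> carrier (loop_group M p E)"
  unfolding deck_group_def inverse_limit_group_def by (auto dest: inverse_limit_in)

lemma G_bond: "g \<in> carrier G \<Longrightarrow> D \<in> Ent \<Longrightarrow> E \<in> Ent \<Longrightarrow> D \<subseteq> E \<Longrightarrow> chain_bond M E D (g D) = g E"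
  unfolding deck_group_def inverse_limit_group_def
  by (auto dest!: inverse_limit_bond[where i = E and j = D] simp: reverse_inclusion_def)

lemma group_G: "group G"
  unfolding deck_group_def
  using group_loop_group[OF tol p] chain_bond_hom[of _ _ M p]
  by (intro group_inverse_limit_group) (auto simp: reverse_inclusion_def)

text \<open>
  The endpoint map of the limit. All coordinates have the same endpoint; the entourage \<open>M \<times> M\<close>
  is a convenient index, since it contains all the others.
\<close>

definition foot :: "('a rel \<Rightarrow> 'a list set) \<Rightarrow> 'a" where
  "foot x = endpoint (x (M \<times> M))"

lemma foot: "x \<in> Y \<Longrightarrow> E \<in> Ent \<Longrightarrow> endpoint (x E) = foot x"
proof -
  assume x: "x \<in> Y" and E: "E \<in> Ent"
  have "E \<subseteq> M \<times> M" using E by (auto simp: entourages_def)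
  thus "endpoint (x E) = foot x"
    unfolding foot_def using endpoint_chain_bond[OF _ Y_in[OF x E]] Y_bond[OF x E B_Ent[OF Times]] by metis
qed

lemma foot_in: "x \<in> Y \<Longrightarrow> foot x \<in> M"
  using endpoint_in[OF Y_in[OF _ B_Ent[OF Times]]] by (simp add: foot_def)

text \<open>
  For the entourage \<open>M \<times> M\<close> every point is reached from \<open>p\<close> by a single step, and the limit maps
  onto the corresponding space of classes.
\<close>

lemma foot_onto:
  assumes "m \<in> M"
  obtains x where "x \<in> Y" "foot x = m"
proof -
  have *: "is_chain M (M \<times> M) [p, m]" using p assms by (simp add: is_chain_def)
  hence "chain_class M (M \<times> M) [p, m] \<in> (\<lambda>x. x (M \<times> M)) ` Y"
    unfolding onto[OF Times] chain_space_iff by (intro exI[of _ "[p, m]"]) simp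
  then obtain x where "x \<in> Y" "x (M \<times> M) = chain_class M (M \<times> M) [p, m]" by force
  thus thesis using that[of x] endpoint_class[OF *] by (simp add: foot_def)
qed

section \<open>The metric of the limit\<close>

text \<open>
  Only the coordinate at the entourage of size \<open>r\<close> is compared, with that same entourage as the
  bound on the last step. This choice makes scales add exactly.
\<close>

definition near :: "real \<Rightarrow> ('a rel \<Rightarrow> 'a list set) \<Rightarrow> ('a rel \<Rightarrow> 'a list set) \<Rightarrow> bool" where
  "near r x y \<longleftrightarrow> (x (N r), y (N r)) \<in> lift_entourage M p (N r) (N r)"

abbreviation "dY \<equiv> scale_dist near Y"

lemma near_lift:
  assumes "near r x y" "0 < r" "N r \<subseteq> E" "E \<in> Ent" "x \<in> Y" "y \<in> Y"
  shows "(x E, y E) \<in> lift_entourage M p E (N r)"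
  using lift_chain_bond[OF tol tol tol order_refl assms(3) assms(1)[unfolded near_def]]
    Y_bond[OF assms(5) N_Ent] Y_bond[OF assms(6) N_Ent] assms N_Ent by simp

lemma lift_near:
  assumes "(x E, y E) \<in> lift_entourage M p E E" "E \<in> Ent" "E \<subseteq> N r" "0 < r" "x \<in> Y" "y \<in> Y"
  shows "near r x y"
proof -
  have "(x (N r), y (N r)) \<in> lift_entourage M p (N r) E"
    using lift_chain_bond[OF tol tol tol order_refl assms(3) assms(1)]
      Y_bond[OF assms(5,2) N_Ent] Y_bond[OF assms(6,2) N_Ent] assms N_Ent by simp
  thus ?thesis unfolding near_def using lift_mono[OF assms(3)] by blast
qed

lemma near_foot: "near r x y \<Longrightarrow> 0 < r \<Longrightarrow> x \<in> Y \<Longrightarrow> y \<in> Y \<Longrightarrow> d (foot x) (foot y) < r"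
  unfolding near_def using endpoint_lift[of "x (N r)" "y (N r)"] foot[OF _ N_Ent]
  by (auto simp: metric_entourage_def)

text \<open>
  Finiteness of the distance: over a scale that exceeds all distances between the vertices of two
  representing chains, both chains contract to single edges from \<open>p\<close>.
\<close>

lemma near_ex:
  assumes x: "x \<in> Y" and y: "y \<in> Y"
  shows "\<exists>r>0. near r x y"
proof -
  have N1: "N 1 \<in> Ent" by (rule N_Ent) simp
  obtain c where c: "is_chain M (N 1) c" "hd c = p" "x (N 1) = chain_class M (N 1) c"
    using Y_in[OF x N1] by (rule chain_space_E)
  obtain e where e: "is_chain M (N 1) e" "hd e = p" "y (N 1) = chain_class M (N 1) e"
    using Y_in[OF y N1] by (rule chain_space_E)
  let ?A = "set c \<union> set e"
  \<comment> \<open>Every two vertices of the two chains are less than \<open>r\<close> apart, and \<open>1 < r\<close>.\<close>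
  define r where "r = Max (insert 1 ((\<lambda>(u, v). d u v) ` (?A \<times> ?A))) + 1"
  have le: "t < r" if "t \<in> insert 1 ((\<lambda>(u, v). d u v) ` (?A \<times> ?A))" for t
    using Max_ge[OF _ that] by (simp add: r_def)
  have r: "1 < r" "0 < r" using le[of 1] by simp_all
  have A: "?A \<subseteq> M" using c e by (auto simp: is_chain_def)
  have A_N: "(u, v) \<in> N r" if "u \<in> ?A" "v \<in> ?A" for u v
    using le[of "d u v"] that A by (auto simp: metric_entourage_def)
  note Nr = N_Ent[OF r(2)]
  have ends: "chain_class M (N r) c = chain_class M (N r) [p, last c]"
    "chain_class M (N r) e = chain_class M (N r) [p, last e]"
    using homotopic_clique[OF tol[OF Nr], of c] homotopic_clique[OF tol[OF Nr], of e] A_N c e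
    by (auto simp: chain_class_eq_iff dest: is_chain_not_Nil)
  have "N 1 \<subseteq> N r" using r by (intro N_mono) simp
  hence "x (N r) = chain_class M (N r) [p, last c]" "y (N r) = chain_class M (N r) [p, last e]"
    using Y_bond[OF x N1 Nr] Y_bond[OF y N1 Nr] c e ends by (simp_all add: chain_bond_class)
  moreover have mem: "p \<in> ?A" "last c \<in> ?A" "last e \<in> ?A"
    using c e is_chain_not_Nil[OF c(1)] is_chain_not_Nil[OF e(1)] by (metis UnCI hd_in_set last_in_set)+
  have "is_chain M (N r) [p, last c]" "is_chain M (N r) [p, last e]" "(last c, last e) \<in> N r"
    using A_N mem A p by (auto simp: is_chain_Cons is_chain_singleton)
  ultimately have "near r x y"
    unfolding near_def lift_entourage_def
    by (intro CollectI exI[of _ "[p]"] exI[of _ "last c"] exI[of _ "last e"]) simp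
  thus ?thesis using r(2) by blast
qed

lemma limit_eqI:
  assumes "x \<in> Y" "y \<in> Y" "\<And>r. 0 < r \<Longrightarrow> x (N r) = y (N r)"
  shows "x = y"
proof (rule inverse_limit_eqI[OF assms(1,2)[unfolded chain_limit_def]])
  fix E assume E: "E \<in> Ent"
  then obtain r where "0 < r" "N r \<subseteq> E" by (rule entourage_contains_metric)
  thus "x E = y E"
    using Y_bond[OF assms(1) N_Ent E] Y_bond[OF assms(2) N_Ent E] assms(3) by metis
qed

sublocale scales near Y
proof
  fix r x assume "0 < (r::real)" "x \<in> Y"
  thus "near r x x" unfolding near_def using lift_refl[OF tol tol] N_Ent Y_in by blast
next
  fix r x y assume "0 < (r::real)" "near r x y"
  thus "near r y x" unfolding near_def using lift_sym[OF tol[OF N_Ent]] by blast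
next
  fix r s :: real and x y z
  assume r: "0 < r" and s: "0 < s" and Y: "x \<in> Y" "y \<in> Y" "z \<in> Y"
    and xy: "near r x y" and yz: "near s y z"
  have rs: "N r \<subseteq> N (r + s)" "N s \<subseteq> N (r + s)" "0 < r + s"
    using r s N_mono[of r "r + s"] N_mono[of s "r + s"] by simp_all
  note tols = tol[OF N_Ent[OF r]] tol[OF N_Ent[OF s]] tol[OF N_Ent[OF rs(3)]]
  \<comment> \<open>At scale \<open>r + s\<close> the two steps from \<open>x\<close> to \<open>z\<close> merge into one, by the triangle inequality in \<open>M\<close>.\<close>
  have "d (foot x) (foot z) < r + s"
    using near_foot[OF xy r Y(1,2)] near_foot[OF yz s Y(2,3)] triangle[of "foot x" "foot y" "foot z"] foot_in Y
    by fastforce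
  hence "(endpoint (x (N (r + s))), endpoint (z (N (r + s)))) \<in> N (r + s)"
    using Y foot_in foot[OF _ N_Ent[OF rs(3)]] by (simp add: metric_entourage_def)
  thus "near (r + s) x z"
    unfolding near_def
    using lift_trans[OF tols(3,1) rs(1) tols(2) rs(2) tols(3) order_refl
        near_lift[OF xy r rs(1) N_Ent[OF rs(3)] Y(1,2)] near_lift[OF yz s rs(2) N_Ent[OF rs(3)] Y(2,3)]]
    by blast
next
  fix x y assume "x \<in> Y" "y \<in> Y"
  thus "\<exists>r>0. near r x y" by (rule near_ex)
next
  fix x y assume Y: "x \<in> Y" "y \<in> Y" and near: "\<And>r. 0 < r \<Longrightarrow> near r x y"
  have "d (foot x) (foot y) \<le> 0"
    using near_foot[OF near _ Y] by (meson dense_ge less_imp_le)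
  hence "foot x = foot y" using foot_in Y by (metis nonneg order_antisym zero)
  hence "x (N r) = y (N r)" if "0 < r" for r
    using lift_same_endpoint[OF near[OF that, unfolded near_def]] that N_Ent
      foot[OF Y(1)] foot[OF Y(2)] by simp
  thus "x = y" by (rule limit_eqI[OF Y])
qed

lemma dY_less_lift:
  assumes "x \<in> Y" "y \<in> Y" "dY x y < r" "0 < r" "N r \<subseteq> E" "E \<in> Ent"
  shows "(x E, y E) \<in> lift_entourage M p E (N r)"
  using near_lift[OF scale_dist_lessD[OF assms(1-3)] assms(4-6,1,2)] .

lemma d_le_dY:
  assumes "x \<in> Y" "y \<in> Y"
  shows "d (foot x) (foot y) \<le> dY x y"
proof (rule dense_ge)
  fix r assume r: "dY x y < r"
  hence "0 < r" using scale_dist_nonneg[of x y] by linarith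
  thus "d (foot x) (foot y) \<le> r" using near_foot[OF scale_dist_lessD[OF assms r] _ assms] by simp
qed

lemma uniform_Y: "uniform_space_on Y (metric_uniformity Y dY)"
  using uniform_space_on_metric Metric_space_scale_dist .

section \<open>Universality\<close>

definition q :: "'a rel \<Rightarrow> 'a list set" where
  "q = (\<lambda>E\<in>Ent. chain_class M E [p])"

lemma q_in: "q \<in> Y"
  unfolding chain_limit_def q_def using base_class_in[OF p]
  by (intro inverse_limitI) (auto simp: reverse_inclusion_def chain_bond_class)

text \<open>
  The preimages of the entourages \<open>E\<^sup>*\<close>. For \<open>E \<in> B\<close> they form the base that witnesses universality.
\<close>

definition pulled :: "'a rel \<Rightarrow> ('a rel \<Rightarrow> 'a list set) rel" where
  "pulled E = {(x, y). x \<in> Y \<and> y \<in> Y \<and> (x E, y E) \<in> lift_entourage M p E E}"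

lemma pulled_entourage:
  assumes "E \<in> B"
  shows "pulled E \<in> entourages Y (metric_uniformity Y dY)"
proof -
  have E: "E \<in> Ent" using assms by (rule B_Ent)
  obtain r where r: "0 < r" "N r \<subseteq> E" using E by (rule entourage_contains_metric)
  have "sym (pulled E)" using lift_sym[OF tol[OF E]] by (auto simp: pulled_def intro!: symI)
  moreover have "(x, y) \<in> pulled E" if "x \<in> Y" "y \<in> Y" "dY x y < r" for x y
    using dY_less_lift[OF that r E] lift_mono[OF r(2)] that by (auto simp: pulled_def)
  hence "\<forall>\<^sub>F z in metric_uniformity Y dY. z \<in> pulled E"
    unfolding eventually_metric_uniformity using r(1) by (auto simp: metric_entourage_def)
  ultimately show ?thesis by (auto simp: entourages_def pulled_def)
qed

lemma pulled_small:
  assumes "0 < r"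
  obtains E where "E \<in> B" "pulled E \<subseteq> metric_entourage Y dY r"
proof -
  have r2: "0 < r / 2" using assms by simp
  obtain E where E: "E \<in> B" "E \<subseteq> N (r / 2)" using B_below[OF N_Ent[OF r2]] by blast
  have "dY x y < r" if "x \<in> Y" "y \<in> Y" "(x E, y E) \<in> lift_entourage M p E E" for x y
    using scale_dist_le[OF r2 that(1,2) lift_near[OF that(3) B_Ent[OF E(1)] E(2) r2 that(1,2)]] assms
    by linarith
  hence "pulled E \<subseteq> metric_entourage Y dY r" by (auto simp: pulled_def metric_entourage_def)
  thus thesis using that E(1) by blast
qed

lemma universal_Y: "universal Y q (metric_uniformity Y dY)"
  unfolding universal_def
proof (intro exI conjI ballI)
  show "entourage_base Y (metric_uniformity Y dY) (pulled ` B)"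
    unfolding entourage_base_def
  proof (intro conjI ballI)
    show "pulled ` B \<subseteq> entourages Y (metric_uniformity Y dY)" using pulled_entourage by blast
    fix E assume "E \<in> entourages Y (metric_uniformity Y dY)"
    then obtain r where r: "0 < r" "metric_entourage Y dY r \<subseteq> E" by (rule entourage_contains_metric)
    obtain F where "F \<in> B" "pulled F \<subseteq> metric_entourage Y dY r" using r(1) by (rule pulled_small)
    thus "\<exists>D\<in>pulled ` B. D \<subseteq> E" using r(2) by blast
  qed
  fix W assume "W \<in> pulled ` B"
  then obtain E where E: "E \<in> B" "W = pulled E" by blast
  interpret chain_pullback M E p "\<lambda>x. x E" Y q
    using tol[OF B_Ent[OF E(1)]] p onto[OF E(1)] q_in B_Ent[OF E(1)]
    by unfold_locales (simp_all add: q_def)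
  have "W = chain_pullback.W M E p (\<lambda>x. x E) Y" by (simp add: E(2) pulled_def W_def)
  thus "uniform_homeomorphism (chain_space Y q W) (chain_uniformity Y q (metric_uniformity Y dY) W)
      Y (metric_uniformity Y dY) endpoint"
    using uniform_homeomorphism_endpoint[OF uniform_Y] pulled_entourage[OF E(1)] E(2) bij_betw_endpoint
    by simp
qed

section \<open>The action of the deck group\<close>

definition translate :: "('a rel \<Rightarrow> 'a list set) \<Rightarrow> ('a rel \<Rightarrow> 'a list set) \<Rightarrow> ('a rel \<Rightarrow> 'a list set)" where
  "translate g x = (\<lambda>E\<in>Ent. concat_class M E (g E) (x E))"

definition deck_action :: "('a rel \<Rightarrow> 'a list set) \<Rightarrow> ('a rel \<Rightarrow> 'a list set) \<Rightarrow> ('a rel \<Rightarrow> 'a list set)" where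
  "deck_action g = (\<lambda>x\<in>Y. translate g x)"

lemma translate_in:
  assumes g: "g \<in> carrier G" and x: "x \<in> Y"
  shows "translate g x \<in> Y"
  unfolding chain_limit_def
proof (rule inverse_limitI)
  fix E assume "E \<in> Ent"
  thus "translate g x E \<in> chain_space M p E"
    using concat_class_in[OF G_in[OF g] Y_in[OF x]] by (simp add: translate_def)
next
  fix E D assume "(E, D) \<in> reverse_inclusion Ent"
  hence ED: "E \<in> Ent" "D \<in> Ent" "D \<subseteq> E" by (auto simp: reverse_inclusion_def)
  show "chain_bond M E D (translate g x D) = translate g x E"
    using concat_class_chain_bond[OF ED(3) G_in[OF g ED(2)] Y_in[OF x ED(2)]]
      G_bond[OF g ED(2,1,3)] Y_bond[OF x ED(2,1,3)] ED by (simp add: translate_def)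
qed (simp add: translate_def)

lemma group_action_deck_action: "group_action G Y deck_action"
proof -
  have one: "\<one>\<^bsub>G\<^esub> E = chain_class M E [p]" if "E \<in> Ent" for E
    using that by (simp add: deck_group_def inverse_limit_group_def one_loop_group)
  have mult: "(g \<otimes>\<^bsub>G\<^esub> h) E = concat_class M E (g E) (h E)" if "E \<in> Ent" for g h E
    using that by (simp add: deck_group_def inverse_limit_group_def mult_loop_group)
  have eqI: "x = y" if "x \<in> Y" "y \<in> Y" "\<And>E. E \<in> Ent \<Longrightarrow> x E = y E" for x y
    using that inverse_limit_eqI unfolding chain_limit_def by blast
  have "group_action G Y (\<lambda>g. \<lambda>x\<in>Y. translate g x)"
  proof (rule group_actionI[OF group_G translate_in])
    fix x assume x: "x \<in> Y"
    show "translate \<one>\<^bsub>G\<^esub> x = x"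
      using concat_class_one[OF p Y_in[OF x]] one x
        translate_in[OF monoid.one_closed[OF group.is_monoid[OF group_G]] x]
      by (intro eqI) (auto simp: translate_def)
    fix g h assume g: "g \<in> carrier G" and h: "h \<in> carrier G"
    have gh: "g \<otimes>\<^bsub>G\<^esub> h \<in> carrier G"
      using g h group_G by (simp add: group.is_monoid monoid.m_closed)
    show "translate (g \<otimes>\<^bsub>G\<^esub> h) x = translate g (translate h x)"
    proof (rule eqI)
      fix E assume E: "E \<in> Ent"
      show "translate (g \<otimes>\<^bsub>G\<^esub> h) x E = translate g (translate h x) E"
        using concat_class_assoc[OF G_in[OF g E] G_in[OF h E] Y_in[OF x E]] E mult[OF E]
        by (simp add: translate_def)
    qed (use translate_in g h x gh in blast)+
  qed
  thus ?thesis by (simp add: deck_action_def[abs_def])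
qed

lemma near_translate:
  assumes "g \<in> carrier G" "0 < r" "near r x y"
  shows "near r (translate g x) (translate g y)"
  using concat_class_lift[OF tol tol order_refl G_in[OF assms(1)]] assms(2,3) N_Ent
  by (simp add: near_def translate_def)

lemma isometric_deck_action: "isometric_action G Y dY deck_action"
proof -
  interpret act: group_action G Y deck_action by (rule group_action_deck_action)
  interpret group G by (rule group_G)
  have "dY (deck_action g x) (deck_action g y) = dY x y" if g: "g \<in> carrier G" and xy: "x \<in> Y" "y \<in> Y" for g x y
  proof -
    have undo: "translate (inv\<^bsub>G\<^esub> g) (translate g x) = x" if x: "x \<in> Y" for x
      using act.orbit_sym_aux[OF g x, of "deck_action g x"] x translate_in[OF g x] by (simp add: deck_action_def)
    have "near r (translate g x) (translate g y) \<longleftrightarrow> near r x y" if r: "0 < r" for r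
      using near_translate[OF g r, of x y] undo xy
        near_translate[OF inv_closed[OF g] r, of "translate g x" "translate g y"] by auto
    hence "{r. 0 < r \<and> near r (translate g x) (translate g y)} = {r. 0 < r \<and> near r x y}" by blast
    thus ?thesis using xy translate_in[OF g] by (simp add: scale_dist_def deck_action_def)
  qed
  thus ?thesis using group_action_deck_action by (simp add: isometric_action_def)
qed

lemma uniform_action_deck_action: "uniform_action G Y (metric_uniformity Y dY) deck_action"
proof (rule uniform_actionI[OF uniform_Y group_action_deck_action])
  fix g assume g: "g \<in> carrier G"
  have "deck_action g \<in> Y \<rightarrow> Y" using translate_in[OF g] by (simp add: deck_action_def)
  hence "uniformly_continuous_between Y (metric_uniformity Y dY) Y (metric_uniformity Y dY) (deck_action g)"
    using isometric_deck_action g unfolding uniformly_continuous_between_metric isometric_action_def by auto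
  thus "filterlim (\<lambda>(x, y). (deck_action g x, deck_action g y)) (metric_uniformity Y dY) (metric_uniformity Y dY)"
    by (simp add: uniformly_continuous_between_def)
qed

lemma foot_translate: "g \<in> carrier G \<Longrightarrow> x \<in> Y \<Longrightarrow> foot (translate g x) = foot x"
  using concat_class_in(2)[OF G_in Y_in] B_Ent[OF Times] by (simp add: foot_def translate_def)

text \<open>
  The difference loops of the coordinates are compatible with the bonding maps and so form an
  element of the deck group.
\<close>

lemma deck_transitive:
  assumes x: "x \<in> Y" and y: "y \<in> Y" and eq: "foot x = foot y"
  shows "\<exists>g\<in>carrier G. translate g x = y"
proof -
  let ?g = "\<lambda>E\<in>Ent. difference_loop M E (x E) (y E)"
  have same: "endpoint (x E) = endpoint (y E)" if "E \<in> Ent" for E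
    using foot[OF x that] foot[OF y that] eq by simp
  note dl = difference_loop[OF tol Y_in[OF x] Y_in[OF y] same]
  have "?g \<in> inverse_limit Ent (reverse_inclusion Ent) (\<lambda>E. carrier (loop_group M p E)) (chain_bond M)"
  proof (rule inverse_limitI)
    fix E D assume "(E, D) \<in> reverse_inclusion Ent"
    hence ED: "E \<in> Ent" "D \<in> Ent" "D \<subseteq> E" by (auto simp: reverse_inclusion_def)
    show "chain_bond M E D (?g D) = ?g E"
      using difference_loop_chain_bond[OF tol[OF ED(2)] tol[OF ED(1)] ED(3) Y_in[OF x ED(2)]
          Y_in[OF y ED(2)] same[OF ED(2)]] Y_bond[OF x ED(2,1,3)] Y_bond[OF y ED(2,1,3)] ED by simp
  qed (use dl(1) in simp_all)
  hence g: "?g \<in> carrier G" by (simp add: deck_group_def inverse_limit_group_def)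
  moreover have "translate ?g x = y"
    by (rule inverse_limit_eqI[OF translate_in[OF g x, unfolded chain_limit_def]
          y[unfolded chain_limit_def]]) (simp add: translate_def dl(2))
  ultimately show ?thesis by blast
qed

definition fibre :: "'a \<Rightarrow> ('a rel \<Rightarrow> 'a list set) set" where
  "fibre m = {x \<in> Y. foot x = m}"

lemma orbit_eq_fibre:
  assumes x: "x \<in> Y"
  shows "orbit G deck_action x = fibre (foot x)"
proof
  show "orbit G deck_action x \<subseteq> fibre (foot x)"
    using translate_in[OF _ x] foot_translate[OF _ x] x by (auto simp: orbit_def fibre_def deck_action_def)
  show "fibre (foot x) \<subseteq> orbit G deck_action x"
  proof
    fix y assume "y \<in> fibre (foot x)"
    then obtain g where "g \<in> carrier G" "translate g x = y"
      using deck_transitive[OF x, of y] by (auto simp: fibre_def)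
    thus "y \<in> orbit G deck_action x" using x by (auto simp: orbit_def deck_action_def)
  qed
qed

lemma orbits_eq_fibres: "orbits G Y deck_action = fibre ` M"
proof
  show "orbits G Y deck_action \<subseteq> fibre ` M" using foot_in by (auto simp: orbits_def orbit_eq_fibre)
  show "fibre ` M \<subseteq> orbits G Y deck_action"
  proof
    fix A assume "A \<in> fibre ` M"
    then obtain m where m: "m \<in> M" "A = fibre m" by blast
    obtain x where "x \<in> Y" "foot x = m" using m(1) by (rule foot_onto)
    thus "A \<in> orbits G Y deck_action" using m(2) orbit_eq_fibre by (auto simp: orbits_def)
  qed
qed

text \<open>
  The endpoint map does not increase distances, so the ball around \<open>x\<close> of radius
  \<open>d (foot x) (foot y)\<close> misses the fibre over \<open>foot y\<close>.
\<close>

lemma closed_orbits: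
  assumes y: "y \<in> Y"
  shows "closedin (Metric_space.mtopology Y dY) (orbit G deck_action y)"
proof -
  interpret Y: Metric_space Y dY by (rule Metric_space_scale_dist)
  have "\<exists>r>0. disjnt (fibre (foot y)) (Y.mball x r)" if x: "x \<in> Y - fibre (foot y)" for x
  proof (intro exI conjI)
    have "foot x \<noteq> foot y" using x by (auto simp: fibre_def)
    thus "0 < d (foot x) (foot y)" using x y foot_in by (metis DiffD1 mdist_pos_less)
    have "\<not> dY x z < d (foot x) (foot y)" if "z \<in> fibre (foot y)" for z
      using d_le_dY[of x z] x that by (auto simp: fibre_def)
    thus "disjnt (fibre (foot y)) (Y.mball x (d (foot x) (foot y)))"
      by (auto simp: disjnt_iff)
  qed
  moreover have "fibre (foot y) \<subseteq> Y" by (auto simp: fibre_def)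
  ultimately show ?thesis unfolding orbit_eq_fibre[OF y] Y.closedin_metric by blast
qed

section \<open>The metric quotient\<close>

lemma fibre_nonempty: "m \<in> M \<Longrightarrow> fibre m \<noteq> {}"
  using foot_onto by (auto simp: fibre_def)

lemma d_le_orbit_dist:
  assumes "m \<in> M" "n \<in> M"
  shows "d m n \<le> orbit_dist dY (fibre m) (fibre n)"
  unfolding orbit_dist_def
proof (rule cInf_greatest)
  show "{dY a b |a b. a \<in> fibre m \<and> b \<in> fibre n} \<noteq> {}"
    using fibre_nonempty[OF assms(1)] fibre_nonempty[OF assms(2)] by blast
qed (use d_le_dY in \<open>auto simp: fibre_def\<close>)

lemma orbit_dist_le:
  assumes "a \<in> fibre m" "b \<in> fibre n"
  shows "orbit_dist dY (fibre m) (fibre n) \<le> dY a b"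
  unfolding orbit_dist_def using assms scale_dist_nonneg
  by (intro cInf_lower bdd_belowI[of _ 0]) auto

text \<open>
  Surjectivity of the projection to \<open>X\<^sub>F\<close> lifts a short step \<open>(m, n) \<in> F\<close> in \<open>X\<close> to a short step
  in the limit: the class of a chain to \<open>m\<close>, prolonged by \<open>n\<close>, is the projection of some point.
\<close>

lemma orbit_dist_small:
  assumes "0 < e"
  shows "\<exists>r>0. \<forall>m\<in>M. \<forall>n\<in>M. d m n < r \<longrightarrow> orbit_dist dY (fibre m) (fibre n) < e"
proof -
  obtain F where F: "F \<in> B" "pulled F \<subseteq> metric_entourage Y dY e" using assms by (rule pulled_small)
  have FE: "F \<in> Ent" using F(1) by (rule B_Ent)
  then obtain r where r: "0 < r" "N r \<subseteq> F" by (rule entourage_contains_metric)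
  have "orbit_dist dY (fibre m) (fibre n) < e" if mn: "m \<in> M" "n \<in> M" "d m n < r" for m n
  proof -
    obtain x where x: "x \<in> Y" "foot x = m" using mn(1) by (rule foot_onto)
    obtain c where c: "is_chain M F c" "hd c = p" "x F = chain_class M F c"
      using Y_in[OF x(1) FE] by (rule chain_space_E)
    have "last c = m" using foot[OF x(1) FE] x(2) c(3) endpoint_class[OF c(1)] by simp
    hence step: "(last c, n) \<in> F" using mn r(2) by (auto simp: metric_entourage_def)
    have lift: "(x F, chain_class M F (c @ [n])) \<in> lift_entourage M p F F"
      unfolding c(3) lift_class_iff[OF tol[OF FE] tol[OF FE] order_refl c(1,2)] using step by blast
    have "chain_class M F (c @ [n]) \<in> (\<lambda>x. x F) ` Y"
      unfolding onto[OF F(1)] using lift_in_space(2)[OF lift] .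
    then obtain y where y: "y \<in> Y" "y F = chain_class M F (c @ [n])" by auto
    have "is_chain M F (c @ [n])"
      using is_chain_snoc[OF tol[OF FE] is_chain_not_Nil[OF c(1)]] c(1) step by blast
    hence "foot y = n" using foot[OF y(1) FE] y(2) by (simp add: endpoint_class)
    moreover have "dY x y < e" using F(2) lift x(1) y by (auto simp: pulled_def metric_entourage_def)
    ultimately show ?thesis using orbit_dist_le[of x m y n] x y by (auto simp: fibre_def)
  qed
  thus ?thesis using r(1) by blast
qed

lemma uniform_homeomorphism_fibre:
  "uniform_homeomorphism M U (orbits G Y deck_action) (metric_uniformity (orbits G Y deck_action) (orbit_dist dY)) fibre"
proof -
  have inj: "inj_on fibre M"
    using fibre_nonempty by (intro inj_onI) (auto simp: fibre_def)
  have inv: "inv_into M fibre (fibre m) = m" if "m \<in> M" for m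
    using inj that by (rule inv_into_f_f)
  have "\<exists>r>0. \<forall>x\<in>orbits G Y deck_action. \<forall>y\<in>orbits G Y deck_action. orbit_dist dY x y < r \<longrightarrow>
      d (inv_into M fibre x) (inv_into M fibre y) < e" if "0 < e" for e
    using that d_le_orbit_dist inv
    by (intro exI[of _ e]) (auto simp: orbits_eq_fibres intro: le_less_trans)
  thus ?thesis
    unfolding uniform_homeomorphism_def uniformly_continuous_between_metric
    using inj inv orbit_dist_small by (auto simp: bij_betw_def orbits_eq_fibres)
qed

section \<open>The action as an inverse limit of discrete actions\<close>

text \<open>
  The action is exhibited as an inverse limit over \<open>B\<close> instead of all entourages, because coverability
  provides surjective projections for the members of \<open>B\<close>. As \<open>B\<close> is cofinal, restriction of the
  index set identifies the limit spaces as well as the limit groups.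
\<close>

abbreviation "base_limit \<equiv> inverse_limit B (reverse_inclusion B) (chain_space M p) (chain_bond M)"

lemma B_nonempty: "B \<noteq> {}" and B_cofinal: "E \<in> Ent \<Longrightarrow> \<exists>D\<in>B. (E, D) \<in> reverse_inclusion Ent"
  using Times B_below B_Ent by (auto simp: reverse_inclusion_def)

lemma B_directed: "directed_set B (reverse_inclusion B)"
  using B_below[OF entourages_Int[OF B_Ent B_Ent]] B_nonempty
  by (intro directed_set_reverse_inclusion) auto

lemma Ent_directed: "directed_set Ent (reverse_inclusion Ent)"
  using B_Ent[OF Times] entourages_Int by (intro directed_set_reverse_inclusion) blast+

lemma B_reverse_inclusion: "reverse_inclusion Ent \<inter> B \<times> B = reverse_inclusion B"
  using B_Ent by (auto simp: reverse_inclusion_def)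

lemma restrict_bij_space: "bij_betw (\<lambda>x. restrict x B) Y base_limit"
  unfolding chain_limit_def
  using inverse_limit_restrict_bij[OF inverse_system_chain_spaces Ent_directed _ B_cofinal]
    B_Ent B_reverse_inclusion by (auto simp: subset_iff)

lemma restrict_iso_group:
  "(\<lambda>x. restrict x B) \<in> iso G (inverse_limit_group B (reverse_inclusion B) (loop_group M p) (chain_bond M))"
proof -
  have "bij_betw (\<lambda>x. restrict x B) (carrier G)
      (inverse_limit B (reverse_inclusion B) (\<lambda>E. carrier (loop_group M p E)) (chain_bond M))"
    using inverse_limit_restrict_bij[OF inverse_system_loop_groups Ent_directed _ B_cofinal]
      B_Ent B_reverse_inclusion by (auto simp: subset_iff deck_group_def inverse_limit_group_def)
  thus ?thesis
    using B_Ent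
    by (auto simp: iso_def hom_def bij_betw_def deck_group_def inverse_limit_group_def fun_eq_iff restrict_def)
qed

text \<open>
  In one direction, a member of the base of a coordinate uniformity contains a lifted metric
  entourage; in the other, a ball of the metric contains the preimage of \<open>E\<^sup>*\<close> for a single \<open>E \<in> B\<close>.
\<close>

lemma restrict_uniform_homeomorphism:
  "uniform_homeomorphism Y (metric_uniformity Y dY) base_limit
     (inverse_limit_uniformity B (reverse_inclusion B) (chain_space M p) (chain_bond M)
       (chain_uniformity M p U)) (\<lambda>x. restrict x B)"
proof -
  let ?V = "inverse_limit_uniformity B (reverse_inclusion B) (chain_space M p) (chain_bond M)
       (chain_uniformity M p U)"
  let ?R = "\<lambda>x. restrict x B" and ?I = "inv_into Y (\<lambda>x. restrict x B)"
  note bij = restrict_bij_space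
  have R: "?R \<in> Y \<rightarrow> base_limit" using bij by (rule bij_betw_imp_funcset)
  have I: "?I \<in> base_limit \<rightarrow> Y" using bij_betw_imp_funcset[OF bij_betw_inv_into[OF bij]] .
  have I_B: "?I x E = x E" if "x \<in> base_limit" "E \<in> B" for x E
    using bij_betw_inv_into_right[OF bij that(1)] that(2) by (metis restrict_apply')
  have "filterlim (\<lambda>(x, y). (?R x, ?R y)) ?V (metric_uniformity Y dY)"
    unfolding inverse_limit_uniformity_def filterlim_inf filterlim_INF filterlim_filtercomap_iff
      filterlim_principal chain_uniformity_def
  proof (intro conjI ballI)
    show "\<forall>\<^sub>F z in metric_uniformity Y dY. (case z of (x, y) \<Rightarrow> (?R x, ?R y)) \<in> base_limit \<times> base_limit"
      unfolding eventually_metric_uniformity using R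
      by (intro exI[of _ 1]) (auto simp: metric_entourage_def)
    fix E D assume E: "E \<in> B" and D: "D \<in> {D \<in> Ent. D \<subseteq> E}"
    obtain r where r: "0 < r" "N r \<subseteq> D" using D entourage_contains_metric by blast
    have "(x E, y E) \<in> lift_entourage M p E D" if "x \<in> Y" "y \<in> Y" "dY x y < r" for x y
      using dY_less_lift[OF that r(1) _ B_Ent[OF E]] D r(2) lift_mono[OF r(2)] by blast
    thus "\<forall>\<^sub>F z in metric_uniformity Y dY. ((\<lambda>(x, y). (x E, y E)) \<circ> (\<lambda>(x, y). (?R x, ?R y))) z
        \<in> lift_entourage M p E D"
      unfolding eventually_metric_uniformity using r(1) E
      by (intro exI[of _ r]) (auto simp: metric_entourage_def)
  qed
  moreover have "filterlim (\<lambda>(x, y). (?I x, ?I y)) (metric_uniformity Y dY) ?V"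
    unfolding metric_uniformity_def[of Y] filterlim_INF filterlim_principal
  proof
    fix e :: real assume "e \<in> {0<..}"
    hence "0 < e" by simp
    then obtain E where E: "E \<in> B" "pulled E \<subseteq> metric_entourage Y dY e" by (rule pulled_small)
    note EE = B_Ent[OF E(1)]
    have "eventually (\<lambda>z. z \<in> lift_entourage M p E E) (chain_uniformity M p U E)"
      using EE by (auto simp: eventually_chain_uniformity)
    hence "eventually (\<lambda>(x, y). (x E, y E) \<in> lift_entourage M p E E)
        (filtercomap (\<lambda>(x, y). (x E, y E)) (chain_uniformity M p U E))"
      unfolding eventually_filtercomap by (intro exI[of _ "\<lambda>z. z \<in> lift_entourage M p E E"]) auto
    hence "eventually (\<lambda>(x, y). (x E, y E) \<in> lift_entourage M p E E)
        (INF i\<in>B. filtercomap (\<lambda>(x, y). (x i, y i)) (chain_uniformity M p U i))"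
      by (rule filter_leD[OF INF_lower[OF E(1)]])
    hence "\<forall>\<^sub>F (x, y) in ?V. x \<in> base_limit \<and> y \<in> base_limit \<and> (x E, y E) \<in> lift_entourage M p E E"
      unfolding inverse_limit_uniformity_def inf_commute[of "principal _"] eventually_inf_principal
      by (auto elim!: eventually_mono)
    thus "\<forall>\<^sub>F z in ?V. (case z of (x, y) \<Rightarrow> (?I x, ?I y))
        \<in> {(x, y). x \<in> Y \<and> y \<in> Y \<and> dY x y < e}"
    proof (rule eventually_mono)
      fix z assume z: "case z of (x, y) \<Rightarrow> x \<in> base_limit \<and> y \<in> base_limit \<and> (x E, y E) \<in> lift_entourage M p E E"
      obtain x y where xy: "z = (x, y)" by force
      have "(?I x, ?I y) \<in> pulled E"
        using z I I_B[OF _ E(1)] by (auto simp: xy pulled_def)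
      thus "(case z of (x, y) \<Rightarrow> (?I x, ?I y)) \<in> {(x, y). x \<in> Y \<and> y \<in> Y \<and> dY x y < e}"
        using E(2) by (auto simp: xy metric_entourage_def)
    qed
  qed
  ultimately show ?thesis
    using bij R I unfolding uniform_homeomorphism_def uniformly_continuous_between_def by blast
qed

lemma chain_bond_uniformly_continuous:
  assumes "E \<in> Ent" "D \<in> Ent" "D \<subseteq> E"
  shows "uniformly_continuous_between (chain_space M p D) (chain_uniformity M p U D)
           (chain_space M p E) (chain_uniformity M p U E) (chain_bond M E D)"
  unfolding uniformly_continuous_between_def
proof
  show "chain_bond M E D \<in> chain_space M p D \<rightarrow> chain_space M p E"
    using chain_bond_in[OF assms(3)] by blast
  show "filterlim (\<lambda>(x, y). (chain_bond M E D x, chain_bond M E D y))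
      (chain_uniformity M p U E) (chain_uniformity M p U D)"
    unfolding chain_uniformity_def[of M p U E] filterlim_INF filterlim_principal
  proof
    fix F assume F: "F \<in> {F \<in> Ent. F \<subseteq> E}"
    have FD: "F \<inter> D \<in> Ent" using F assms(2) entourages_Int by blast
    have "(chain_bond M E D a, chain_bond M E D b) \<in> lift_entourage M p E F"
      if "(a, b) \<in> lift_entourage M p D (F \<inter> D)" for a b
      using lift_chain_bond[OF tol[OF assms(1)] tol[OF assms(2)] tol[OF FD] _ assms(3) that]
        lift_mono[of "F \<inter> D" F] by blast
    thus "\<forall>\<^sub>F z in chain_uniformity M p U D.
        (case z of (x, y) \<Rightarrow> (chain_bond M E D x, chain_bond M E D y)) \<in> lift_entourage M p E F"
      unfolding eventually_chain_uniformity[OF assms(2)] using FD by (intro bexI[of _ "F \<inter> D"]) auto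
  qed
qed

lemma prodiscrete_deck_action:
  "prodiscrete_action TYPE('a rel) TYPE('a list set) TYPE('a list set)
     G Y (metric_uniformity Y dY) deck_action"
  unfolding prodiscrete_action_def
proof (intro conjI exI)
  show "uniform_action G Y (metric_uniformity Y dY) deck_action" by (rule uniform_action_deck_action)
  show "directed_set B (reverse_inclusion B)" by (rule B_directed)
  show "inverse_system B (reverse_inclusion B) (chain_space M p) (chain_bond M)"
    by (rule inverse_system_chain_spaces)
  show "inverse_system B (reverse_inclusion B) (\<lambda>E. carrier (loop_group M p E)) (chain_bond M)"
    by (rule inverse_system_loop_groups)
  show "\<forall>E\<in>B. discrete_action (loop_group M p E) (chain_space M p E) (chain_uniformity M p U E)
      (loop_action M p E)"
    using discrete_loop_action[OF U B_Ent p] by blast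
  show "\<forall>(E, D)\<in>reverse_inclusion B.
      uniformly_continuous_between (chain_space M p D) (chain_uniformity M p U D)
        (chain_space M p E) (chain_uniformity M p U E) (chain_bond M E D) \<and>
      chain_bond M E D \<in> hom (loop_group M p D) (loop_group M p E) \<and>
      (\<forall>g\<in>carrier (loop_group M p D). \<forall>x\<in>chain_space M p D.
        chain_bond M E D (loop_action M p D g x) =
        loop_action M p E (chain_bond M E D g) (chain_bond M E D x))"
  proof clarify
    fix E D assume "(E, D) \<in> reverse_inclusion B"
    hence ED: "E \<in> Ent" "D \<in> Ent" "D \<subseteq> E" using B_Ent by (auto simp: reverse_inclusion_def)
    show "uniformly_continuous_between (chain_space M p D) (chain_uniformity M p U D)
        (chain_space M p E) (chain_uniformity M p U E) (chain_bond M E D) \<and>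
      chain_bond M E D \<in> hom (loop_group M p D) (loop_group M p E) \<and>
      (\<forall>g\<in>carrier (loop_group M p D). \<forall>x\<in>chain_space M p D.
        chain_bond M E D (loop_action M p D g x) =
        loop_action M p E (chain_bond M E D g) (chain_bond M E D x))"
      using chain_bond_uniformly_continuous[OF ED] chain_bond_hom[OF ED(3)]
        concat_class_chain_bond[OF ED(3)] chain_bond_in[OF ED(3)]
      by (simp add: loop_action_def)
  qed
  show "uniform_homeomorphism Y (metric_uniformity Y dY) base_limit
      (inverse_limit_uniformity B (reverse_inclusion B) (chain_space M p) (chain_bond M)
        (chain_uniformity M p U)) (\<lambda>x. restrict x B)"
    by (rule restrict_uniform_homeomorphism)
  show "\<forall>E\<in>B. (\<lambda>y. restrict y B E) ` Y = chain_space M p E" using onto by simp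
  show "(\<lambda>x. restrict x B) \<in>
      iso G (inverse_limit_group B (reverse_inclusion B) (loop_group M p) (chain_bond M))"
    by (rule restrict_iso_group)
  show "\<forall>g\<in>carrier G. \<forall>y\<in>Y. \<forall>E\<in>B.
      restrict (deck_action g y) B E = loop_action M p E (restrict g B E) (restrict y B E)"
    using B_Ent Y_in by (simp add: deck_action_def translate_def loop_action_def)
qed

end

theorem theorem6:
  fixes M :: "'a set" and d :: "'a \<Rightarrow> 'a \<Rightarrow> real" and p :: 'a
  assumes "Metric_space M d" and "p \<in> M"
    and "coverable M p (metric_uniformity M d)"
  shows "\<exists>(Y :: ('a rel \<Rightarrow> 'a list set) set) dY q (G :: ('a rel \<Rightarrow> 'a list set) monoid) \<phi> f.
           Metric_space Y dY \<and> q \<in> Y \<and>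
           universal Y q (metric_uniformity Y dY) \<and>
           isometric_action G Y dY \<phi> \<and>
           prodiscrete_action TYPE('a rel) TYPE('a list set) TYPE('a list set)
             G Y (metric_uniformity Y dY) \<phi> \<and>
           (\<forall>y\<in>Y. closedin (Metric_space.mtopology Y dY) (orbit G \<phi> y)) \<and>
           G \<cong> deck_group M p (metric_uniformity M d) \<and>
           uniform_homeomorphism M (metric_uniformity M d)
             (orbits G Y \<phi>) (metric_uniformity (orbits G Y \<phi>) (orbit_dist dY)) f"
proof -
  obtain B where "entourage_base M (metric_uniformity M d) B" "M \<times> M \<in> B"
    "\<forall>E\<in>B. (\<lambda>x. x E) ` chain_limit M p (metric_uniformity M d) = chain_space M p E"
    using assms(3) unfolding coverable_def by blast
  then interpret coverable_metric M d p B
    using assms(1,2) by (intro coverable_metric.intro coverable_metric_axioms.intro) auto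
  show ?thesis
    using Metric_space_scale_dist q_in universal_Y isometric_deck_action prodiscrete_deck_action closed_orbits
      iso_refl uniform_homeomorphism_fibre by blast
qed

end
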